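(* Let $d>2$ and let $\mathbf{K}$ be a convex body in $\mathbb{S}^d$ whose boundary contains a partial flag of length $d-2$, i.e., there are faces $F_2\subset F_3\subset\cdots\subset F_{d-1}$ of $\mathbf{K}$ with $\dim F_i=i$ for $i=2,\dots,d-1$. Then $I_{\mathbb{S}^d}(\mathbf{K})=d+1$. In particular, for any convex polytope $\mathbf{P}$ in $\mathbb{S}^d$, $d>2$, we have $I_{\mathbb{S}^d}(\mathbf{P})=d+1$.
   Context: $\mathbb{S}^d$ denotes the unit sphere of Euclidean space $\mathbb{E}^{d+1}$ centered at the origin, regarded as the $d$-dimensional spherical space. A subset of $\mathbb{S}^d$ is spherically convex if it is contained in an open hemisphere of $\mathbb{S}^d$ and, for any two of its points, it contains the spherical segment (the shorter unit circle arc) connecting them. A convex body in $\mathbb{S}^d$ is a compact spherically convex set with nonempty interior. A convex polytope in $\mathbb{S}^d$ is a convex body in $\mathbb{S}^d$ that is an intersection of finitely many closed hemispheres. A face $F$ of a convex body $\mathbf{K}\subset\mathbb{S}^d$ is a spherically convex subset of $\mathbf{K}$ such that any spherical segment contained in $\mathbf{K}$ whose relative interior intersects $F$ is contained in $F$. A partial flag of length $d-s$ is a sequence of faces $F_s\subset\cdots\subset F_{d-1}$ of $\mathbf{K}$ with $\dim F_i=i$ for $i=s,\dots,d-1$. The dimension of a face is the dimension of the smallest greatsphere containing it. Illumination: let $\mathbf{p}\in\mathbb{S}^d\setminus\mathbf{K}$. A boundary point $\mathbf{q}\in\operatorname{bd}\mathbf{K}$ is illuminated from $\mathbf{p}$ if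 $\mathbf{q}\neq-\mathbf{p}$, the spherical segment with endpoints $\mathbf{p},\mathbf{q}$ does not intersect $\operatorname{int}\mathbf{K}$, and the greatcircle through $\mathbf{p}$ and $\mathbf{q}$ does intersect $\operatorname{int}\mathbf{K}$. $\mathbf{K}$ is illuminated from a set $S\subset\mathbb{S}^d\setminus\mathbf{K}$ if every boundary point of $\mathbf{K}$ is illuminated from at least one point of $S$. The illumination number $I_{\mathbb{S}^d}(\mathbf{K})$ is the smallest cardinality of a set $S$ that illuminates $\mathbf{K}$ and lies on a $(d-1)$-dimensional greatsphere of $\mathbb{S}^d$ disjoint from $\mathbf{K}$. *)

theory Defs
  imports "HOL-Analysis.Analysis" "HOL-Library.Extended_Nat"
begin

text \<open>
  For a Euclidean space \<open>'a\<close> of dimension \<open>d + 1\<close>, the spherical space of dimension \<open>d\<close> is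
  \<open>sphere (0::'a) 1\<close>; interiors and boundaries are taken in its subspace topology.
\<close>

abbreviation usphere :: "'a::euclidean_space set" where
  "usphere \<equiv> sphere 0 1"

definition sph_interior :: "'a::euclidean_space set \<Rightarrow> 'a set" where
  "sph_interior K = top_of_set usphere interior_of K"

definition sph_boundary :: "'a::euclidean_space set \<Rightarrow> 'a set" where
  "sph_boundary K = top_of_set usphere frontier_of K"

definition open_hemisphere :: "'a::euclidean_space set \<Rightarrow> bool" where
  "open_hemisphere H \<longleftrightarrow> (\<exists>a\<in>usphere. H = {x \<in> usphere. a \<bullet> x > 0})"

definition closed_hemisphere :: "'a::euclidean_space set \<Rightarrow> bool" where
  "closed_hemisphere H \<longleftrightarrow> (\<exists>a\<in>usphere. H = {x \<in> usphere. a \<bullet> x \<ge> 0})"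

definition greatsphere :: "nat \<Rightarrow> 'a::euclidean_space set \<Rightarrow> bool" where
  "greatsphere k G \<longleftrightarrow> (\<exists>L. subspace L \<and> dim L = k + 1 \<and> G = usphere \<inter> L)"

text \<open>
  The spherical segment is the radial projection of the chord. It is the shorter arc for
  points \<open>p\<close>, \<open>q\<close> of the unit sphere with \<open>p \<noteq> - q\<close>, and is only used for such points.
  The projection of the open chord is the relative interior of the segment when \<open>p \<noteq> q\<close>; it is
  empty when \<open>p = q\<close>, where the defining condition of a face is trivial anyway.
\<close>

definition sph_segment :: "'a::euclidean_space \<Rightarrow> 'a \<Rightarrow> 'a set" where
  "sph_segment p q = sgn ` closed_segment p q"

definition sph_open_segment :: "'a::euclidean_space \<Rightarrow> 'a \<Rightarrow> 'a set" where
  "sph_open_segment p q = sgn ` open_segment p q"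

text \<open>The following set is a greatcircle when \<open>p \<noteq> q\<close> and \<open>p \<noteq> - q\<close>.\<close>

definition greatcircle :: "'a::euclidean_space \<Rightarrow> 'a \<Rightarrow> 'a set" where
  "greatcircle p q = usphere \<inter> span {p, q}"

definition sph_convex :: "'a::euclidean_space set \<Rightarrow> bool" where
  "sph_convex K \<longleftrightarrow>
     (\<exists>H. open_hemisphere H \<and> K \<subseteq> H) \<and> (\<forall>p\<in>K. \<forall>q\<in>K. sph_segment p q \<subseteq> K)"

definition sph_convex_body :: "'a::euclidean_space set \<Rightarrow> bool" where
  "sph_convex_body K \<longleftrightarrow> compact K \<and> sph_convex K \<and> sph_interior K \<noteq> {}"

definition sph_convex_polytope :: "'a::euclidean_space set \<Rightarrow> bool" where
  "sph_convex_polytope P \<longleftrightarrow> sph_convex_body P \<and>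
     (\<exists>\<H>. finite \<H> \<and> (\<forall>H\<in>\<H>. closed_hemisphere H) \<and> P = usphere \<inter> \<Inter>\<H>)"

definition sph_face :: "'a::euclidean_space set \<Rightarrow> 'a set \<Rightarrow> bool" where
  "sph_face F K \<longleftrightarrow> F \<subseteq> K \<and> sph_convex F \<and>
     (\<forall>p\<in>usphere. \<forall>q\<in>usphere. p \<noteq> - q \<and> sph_segment p q \<subseteq> K \<and> sph_open_segment p q \<inter> F \<noteq> {}
        \<longrightarrow> sph_segment p q \<subseteq> F)"

definition has_sph_dim :: "'a::euclidean_space set \<Rightarrow> nat \<Rightarrow> bool" where
  "has_sph_dim F k \<longleftrightarrow>
     (\<exists>G. greatsphere k G \<and> F \<subseteq> G \<and> (\<forall>j G'. greatsphere j G' \<and> F \<subseteq> G' \<longrightarrow> G \<subseteq> G'))"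

definition illuminates_point :: "'a::euclidean_space set \<Rightarrow> 'a \<Rightarrow> 'a \<Rightarrow> bool" where
  "illuminates_point K p q \<longleftrightarrow>
     q \<noteq> - p \<and> sph_segment p q \<inter> sph_interior K = {} \<and> greatcircle p q \<inter> sph_interior K \<noteq> {}"

definition illuminates :: "'a::euclidean_space set \<Rightarrow> 'a set \<Rightarrow> bool" where
  "illuminates K S \<longleftrightarrow>
     S \<subseteq> usphere - K \<and> (\<forall>q\<in>sph_boundary K. \<exists>p\<in>S. illuminates_point K p q)"

text \<open>
  With \<open>DIM('a) = d + 1\<close>, the index \<open>DIM('a) - 2\<close> is \<open>d - 1\<close>. The infimum is \<open>\<infinity>\<close>
  when no finite set is admissible.
\<close>

definition illumination_number :: "'a::euclidean_space set \<Rightarrow> enat" where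
  "illumination_number K =
     (INF S \<in> {S. finite S \<and> illuminates K S \<and>
                  (\<exists>G. greatsphere (DIM('a) - 2) G \<and> G \<inter> K = {} \<and> S \<subseteq> G)}. enat (card S))"

end

theory Submission
  imports Defs
begin

text \<open>
  We pass to the cone \<open>C\<close> over \<open>K\<close>. The light sources lie in a hyperplane \<open>u = 0\<close> with \<open>u > 0\<close> on
  \<open>C - {0}\<close>, and a source \<open>p\<close> illuminates \<open>q\<close> iff \<open>- p\<close> points from \<open>q\<close> into the interior of \<open>C\<close>.

  Upper bound: let \<open>F\<close> be a facet of \<open>C\<close> with inner normal \<open>n\<close>, and suppose that finitely many
  directions in the span of \<open>F\<close> illuminate \<open>F\<close> with respect to a functional \<open>w\<close>. For small
  \<open>\<epsilon>\<close> take \<open>u = n + \<epsilon> w\<close>. Slightly tilted inwards, the old directions illuminate a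
  neighbourhood of \<open>F\<close> that does not depend on \<open>\<epsilon>\<close>, because near a relative interior point of \<open>F\<close> the
  cone is a half-space. One new direction, close to a point in the relative interior of \<open>F\<close>,
  illuminates the rest once \<open>\<epsilon>\<close> is small. So each step of a flag costs one direction.
  The flag starts with a three-dimensional cone, where three directions suffice: either it has a
  two-dimensional face, or a boundary ray together with a tangent there plays the role of \<open>F\<close>.

  Lower bound: for at most \<open>d\<close> sources in a \<open>d\<close>-dimensional subspace there is a nonzero functional
  that is nonnegative on all of them, and a supporting hyperplane with this direction touches \<open>K\<close> at
  a point that is not illuminated.
\<close>

section \<open>Pointed cones and their illumination by directions\<close>

text \<open>A strictly positive functional expresses pointedness because it is the linear form of an
  open hemisphere containing \<open>K\<close>. The cone \<open>{0}\<close> qualifies, which gives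
  inductions over faces their start.\<close>

definition pointed_cone :: "'a::euclidean_space set \<Rightarrow> bool" where
  "pointed_cone C \<longleftrightarrow> convex_cone C \<and> closed C \<and> (\<exists>w. \<forall>x\<in>C - {0}. 0 < w \<bullet> x)"

text \<open>
  A homogeneous form of illumination by \<open>m\<close> directions. The condition \<open>u \<bullet> v < 0\<close> is stronger than
  \<open>u \<bullet> v = 0\<close>: adding a multiple of an interior vector of \<open>C\<close> to \<open>v\<close> turns the former into the
  latter and only helps illumination.
\<close>

definition illuminable :: "'a::euclidean_space set \<Rightarrow> nat \<Rightarrow> bool" where
  "illuminable C m \<longleftrightarrow> (\<exists>u V. finite V \<and> card V \<le> m \<and> (\<forall>x\<in>C - {0}. 0 < u \<bullet> x) \<and>
     (\<forall>v\<in>V. v \<in> span C \<and> u \<bullet> v < 0) \<and>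
     (\<forall>q\<in>C - {0}. \<exists>v\<in>V. \<exists>s>0. q + s *\<^sub>R v \<in> rel_interior C))"

section \<open>Relative interiors of convex cones\<close>

lemma convex_cone_0: "convex_cone C \<Longrightarrow> 0 \<in> C"
  by (simp add: convex_cone_iff)

lemma convex_cone_imp_convex: "convex_cone C \<Longrightarrow> convex C"
  by (simp add: convex_cone_def)

lemma affine_hull_convex_cone:
  fixes C :: "'a::euclidean_space set"
  assumes "convex_cone C"
  shows "affine hull C = span C"
  by (rule affine_hull_span_0[OF hull_inc[OF convex_cone_0[OF assms]]])

lemma aff_dim_convex_cone:
  fixes C :: "'a::euclidean_space set"
  assumes "convex_cone C"
  shows "aff_dim C = int (dim C)"
  using assms by (simp add: aff_dim_zero convex_cone_0 hull_inc)

text \<open>A cone contains 0, so its affine hull is its span. Relative interiors are used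
  throughout because the arguments are also applied to proper faces, which have empty
  interior.\<close>

lemma rel_interior_convex_cone_iff:
  fixes C :: "'a::euclidean_space set"
  assumes "convex_cone C"
  shows "x \<in> rel_interior C \<longleftrightarrow> x \<in> span C \<and> (\<exists>r>0. ball x r \<inter> span C \<subseteq> C)"
  unfolding mem_rel_interior_ball affine_hull_convex_cone[OF assms]
  by (metis Int_iff centre_in_ball span_superset subset_iff)

lemma rel_interior_convex_cone_ball:
  fixes C :: "'a::euclidean_space set"
  assumes "convex_cone C" "x \<in> rel_interior C"
  obtains r where "r > 0" "ball x r \<inter> span C \<subseteq> rel_interior C"
proof -
  obtain r where r: "r > 0" "ball x r \<inter> span C \<subseteq> C"
    using assms rel_interior_convex_cone_iff by blast
  have "ball x (r/2) \<inter> span C \<subseteq> rel_interior C"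
  proof
    fix z assume z: "z \<in> ball x (r/2) \<inter> span C"
    have "ball z (r/2) \<subseteq> ball x r"
    proof
      fix y assume "y \<in> ball z (r/2)"
      then show "y \<in> ball x r"
        using z dist_triangle[of x y z] by auto
    qed
    then show "z \<in> rel_interior C"
      using z r unfolding rel_interior_convex_cone_iff[OF assms(1)]
      by (metis Int_iff Int_mono half_gt_zero order_refl order_trans)
  qed
  with r show ?thesis
    using that[of "r/2"] by simp
qed

text \<open>A relative ball around \<open>x\<close>, translated by \<open>y\<close>, stays in
  \<open>C\<close> because \<open>C\<close> is closed under addition.\<close>

lemma rel_interior_convex_cone_add:
  fixes C :: "'a::euclidean_space set"
  assumes C: "convex_cone C" and x: "x \<in> rel_interior C" and y: "y \<in> C"
  shows "x + y \<in> rel_interior C"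
proof -
  obtain r where r: "r > 0" "ball x r \<inter> span C \<subseteq> C" and xs: "x \<in> span C"
    using C x rel_interior_convex_cone_iff by blast
  have ys: "y \<in> span C"
    using y by (simp add: span_base)
  have "ball (x + y) r \<inter> span C \<subseteq> C"
  proof
    fix z assume z: "z \<in> ball (x + y) r \<inter> span C"
    then have "z - y \<in> ball x r \<inter> span C"
      using ys by (auto simp: dist_norm algebra_simps span_diff)
    then have "z - y \<in> C"
      using r by blast
    then have "(z - y) + y \<in> C"
      using convex_cone_add[OF C _ y] by blast
    then show "z \<in> C" by simp
  qed
  then show ?thesis
    using r xs ys by (auto simp: rel_interior_convex_cone_iff[OF C] span_add)
qed

lemma rel_interior_convex_cone_scaleR:
  fixes C :: "'a::euclidean_space set"
  assumes C: "convex_cone C" and x: "x \<in> rel_interior C" and c: "0 < c"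
  shows "c *\<^sub>R x \<in> rel_interior C"
proof -
  obtain r where r: "r > 0" "ball x r \<inter> span C \<subseteq> C" and xs: "x \<in> span C"
    using C x rel_interior_convex_cone_iff by blast
  have "ball (c *\<^sub>R x) (c * r) \<inter> span C \<subseteq> C"
  proof
    fix z assume z: "z \<in> ball (c *\<^sub>R x) (c * r) \<inter> span C"
    have "norm (c *\<^sub>R (x - z /\<^sub>R c)) = c * norm (x - z /\<^sub>R c)"
      using c by simp
    moreover have "c *\<^sub>R (x - z /\<^sub>R c) = c *\<^sub>R x - z"
      using c by (simp add: scaleR_diff_right)
    ultimately have "c * dist x (z /\<^sub>R c) = dist (c *\<^sub>R x) z"
      by (simp add: dist_norm)
    also have "\<dots> < c * r" using z by simp
    finally have "z /\<^sub>R c \<in> ball x r \<inter> span C"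
      using c z by (auto simp: span_scale)
    then have "z /\<^sub>R c \<in> C"
      using r by blast
    then show "z \<in> C"
      using convex_cone_scaleR[OF C, of c "z /\<^sub>R c"] c by simp
  qed
  then show ?thesis
    using r xs c by (auto simp: rel_interior_convex_cone_iff[OF C] span_scale intro!: exI[of _ "c * r"])
qed

lemma rel_interior_convex_cone_dir:
  fixes C :: "'a::euclidean_space set"
  assumes C: "convex_cone C" and x: "x \<in> rel_interior C" and z: "z \<in> span C"
  obtains s where "s > 0" "x + s *\<^sub>R z \<in> rel_interior C"
proof -
  obtain r where r: "r > 0" "ball x r \<inter> span C \<subseteq> rel_interior C"
    using rel_interior_convex_cone_ball[OF C x] .
  \<comment> \<open>Adding 1 covers \<open>z = 0\<close> and makes the estimate
    \<open>s * norm z < r\<close> strict.\<close>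
  define s where "s = r / (norm z + 1)"
  have s: "s > 0" using r by (simp add: s_def add_nonneg_pos)
  have "s * norm z < s * (norm z + 1)" using s by simp
  also have "\<dots> = r" using add_nonneg_pos[of "norm z" 1] by (simp add: s_def)
  finally have "s * norm z < r" .
  moreover have "x \<in> span C"
    using x rel_interior_convex_cone_iff[OF C] by blast
  ultimately have "x + s *\<^sub>R z \<in> ball x r \<inter> span C"
    using s z by (auto simp: dist_norm span_add span_scale)
  with r s that show ?thesis by blast
qed

lemma pointed_cone_face:
  assumes "pointed_cone C" "F face_of C" "F \<noteq> {}"
  shows "pointed_cone F"
  using assms unfolding pointed_cone_def convex_cone_def
  by (meson Diff_mono face_of_conic face_of_imp_closed face_of_imp_convex face_of_imp_subset order_refl subsetD)

text \<open>If \<open>n\<close> vanished at \<open>x\<close>, a short step from \<open>x\<close>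
  within the span, in a direction on which \<open>n\<close> is negative, would leave the half-space
  containing \<open>C\<close>.\<close>

lemma rel_interior_pos:
  fixes C :: "'a::euclidean_space set"
  assumes C: "convex_cone C" and x: "x \<in> rel_interior C"
    and n: "\<And>x. x \<in> C \<Longrightarrow> 0 \<le> n \<bullet> x" and z: "z \<in> span C" "n \<bullet> z \<noteq> 0"
  shows "0 < n \<bullet> x"
proof -
  define z' where "z' = (if 0 < n \<bullet> z then - z else z)"
  have z': "z' \<in> span C" "n \<bullet> z' < 0"
    using z by (auto simp: z'_def span_neg)
  obtain s where s: "s > 0" "x + s *\<^sub>R z' \<in> rel_interior C"
    using rel_interior_convex_cone_dir[OF C x z'(1)] .
  then have "0 \<le> n \<bullet> (x + s *\<^sub>R z')"
    using n rel_interior_subset by blast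
  then have "0 \<le> n \<bullet> x + s * (n \<bullet> z')"
    by (simp add: inner_simps)
  moreover have "s * (n \<bullet> z') < 0"
    using s z' by (simp add: mult_pos_neg)
  ultimately show ?thesis by linarith
qed

section \<open>Raising the dimension by one at the cost of one direction\<close>

text \<open>Each local bound is valid for all smaller \<epsilon> too, so the minimum over a finite
  subcover works everywhere. This yields one tilt for the whole compact unit section of a
  cone.\<close>

lemma compact_uniformly_small:
  fixes K :: "'a::topological_space set" and R :: "real \<Rightarrow> 'a \<Rightarrow> bool"
  assumes "compact K"
    and loc: "\<And>x. x \<in> K \<Longrightarrow> \<exists>e>0. \<exists>U. open U \<and> x \<in> U \<and> (\<forall>y\<in>U \<inter> K. \<forall>\<epsilon>. 0 < \<epsilon> \<and> \<epsilon> \<le> e \<longrightarrow> R \<epsilon> y)"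
  shows "\<exists>e>0. \<forall>y\<in>K. R e y"
proof -
  obtain e U where eU: "\<And>x. x \<in> K \<Longrightarrow> e x > 0 \<and> open (U x) \<and> x \<in> U x \<and>
      (\<forall>y\<in>U x \<inter> K. \<forall>\<epsilon>. 0 < \<epsilon> \<and> \<epsilon> \<le> e x \<longrightarrow> R \<epsilon> y)"
    using loc by metis
  obtain T where T: "T \<subseteq> K" "finite T" "K \<subseteq> (\<Union>x\<in>T. U x)"
    using compactE_image[OF \<open>compact K\<close>, of K U] eU by blast
  \<comment> \<open>Inserting 1 keeps the minimum defined when the subcover is empty.\<close>
  define m where "m = Min (insert 1 (e ` T))"
  have m: "m > 0" "\<And>x. x \<in> T \<Longrightarrow> m \<le> e x"
    using T eU by (auto simp: m_def)
  have "R m y" if "y \<in> K" for y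
  proof -
    obtain x where "x \<in> T" "y \<in> U x" using T \<open>y \<in> K\<close> by blast
    then show ?thesis using eU[of x] T m that by blast
  qed
  then show ?thesis using m by blast
qed

text \<open>
  The common core of the facet step and of the three-dimensional case. In assumption \<open>A\<close> the
  neighbourhood \<open>U\<close> must not depend on the tilt \<open>e\<close>.
\<close>

lemma illuminable_lift:
  fixes C :: "'a::euclidean_space set"
  assumes C: "pointed_cone C" and a: "a \<in> rel_interior C" "n \<bullet> a = 1"
    and n: "\<And>x. x \<in> C \<Longrightarrow> 0 \<le> n \<bullet> x"
    and y: "y \<in> C" "n \<bullet> y = 0"
    and W: "finite W" "\<And>v. v \<in> W \<Longrightarrow> v \<in> span C \<and> n \<bullet> v = 0 \<and> w \<bullet> v < 0"
    and w: "\<And>x. x \<in> C \<Longrightarrow> x \<noteq> 0 \<Longrightarrow> n \<bullet> x = 0 \<Longrightarrow> 0 < w \<bullet> x"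
    and A: "\<And>x. x \<in> C \<Longrightarrow> x \<noteq> 0 \<Longrightarrow> n \<bullet> x = 0 \<Longrightarrow> \<exists>U. open U \<and> x \<in> U \<and>
       (\<forall>q\<in>U \<inter> C. \<exists>v\<in>W. \<forall>e>0. \<exists>s>0. q + s *\<^sub>R (v + e *\<^sub>R a) \<in> rel_interior C)"
    and B: "\<And>x. x \<in> C \<Longrightarrow> 0 < n \<bullet> x \<Longrightarrow> \<exists>s>0. x + s *\<^sub>R y \<in> rel_interior C"
  shows "illuminable C (Suc (card W))"
proof -
  have cc: "convex_cone C" and cl: "closed C"
    using C by (auto simp: pointed_cone_def)
  have aC: "a \<in> C" "a \<in> span C"
    using a rel_interior_subset span_base by blast+
  \<comment> \<open>The multiple of \<open>n\<close> makes \<open>w0\<close> vanish at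
    \<open>a\<close>, while \<open>w0\<close> agrees with \<open>w\<close> on the hyperplane
    \<open>n = 0\<close>. Hence \<open>u \<epsilon> \<bullet> a = 1\<close> for every
    \<epsilon>.\<close>
  define w0 where "w0 = w - (w \<bullet> a) *\<^sub>R n"
  have w0a: "w0 \<bullet> a = 0"
    using a by (simp add: w0_def inner_simps)
  have w0: "w0 \<bullet> x = w \<bullet> x" if "n \<bullet> x = 0" for x
    using that by (simp add: w0_def inner_simps)
  have w0y: "0 \<le> w0 \<bullet> y"
    using w[of y] y w0[of y] by (cases "y = 0") auto
  define u where "u \<epsilon> = n + \<epsilon> *\<^sub>R w0" for \<epsilon> :: real
  \<comment> \<open>For \<open>v\<close> in \<open>W\<close> this adds a positive multiple of
    \<open>a\<close>, since \<open>w \<bullet> v < 0\<close>. Only half of the admissible amount is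
    used, which leaves \<open>u \<epsilon> \<bullet> D \<epsilon> v = \<epsilon> * (w \<bullet> v) /
    2\<close> negative.\<close>
  define D where "D \<epsilon> v = v - (\<epsilon> * (w \<bullet> v) / 2) *\<^sub>R a" for \<epsilon> :: real and v
  \<comment> \<open>The coefficient is chosen to give
    \<open>u \<epsilon> \<bullet> d \<epsilon> = - \<epsilon>\<close>. It tends to 0 with
    \<epsilon>, so \<open>d \<epsilon>\<close> approaches \<open>y\<close>.\<close>
  define d where "d \<epsilon> = y - (\<epsilon> * (w0 \<bullet> y + 1)) *\<^sub>R a" for \<epsilon> :: real
  define K where "K = C \<inter> sphere 0 1"
  have "compact K"
    unfolding K_def by (intro closed_Int_compact cl compact_sphere)
  define R where "R \<epsilon> q \<longleftrightarrow> 0 < u \<epsilon> \<bullet> q \<and>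
      (\<exists>v\<in>insert (d \<epsilon>) (D \<epsilon> ` W). \<exists>s>0. q + s *\<^sub>R v \<in> rel_interior C)" for \<epsilon> :: real and q
  have "\<exists>e>0. \<exists>U. open U \<and> x \<in> U \<and> (\<forall>q\<in>U \<inter> K. \<forall>\<epsilon>. 0 < \<epsilon> \<and> \<epsilon> \<le> e \<longrightarrow> R \<epsilon> q)" if xK: "x \<in> K" for x
  proof (cases "n \<bullet> x = 0")
    case True
    have x: "x \<in> C" "x \<noteq> 0" using xK by (auto simp: K_def)
    obtain U where U: "open U" "x \<in> U"
      "\<forall>q\<in>U \<inter> C. \<exists>v\<in>W. \<forall>e>0. \<exists>s>0. q + s *\<^sub>R (v + e *\<^sub>R a) \<in> rel_interior C"
      using A[OF x True] by blast
    have "R \<epsilon> q" if q: "q \<in> (U \<inter> {q. 0 < w0 \<bullet> q}) \<inter> K" and \<epsilon>: "0 < \<epsilon>" for q \<epsilon>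
    proof -
      have "0 < u \<epsilon> \<bullet> q"
        using q \<epsilon> n[of q] by (auto simp: u_def inner_simps K_def intro!: add_nonneg_pos)
      moreover obtain v where v: "v \<in> W" "\<forall>e>0. \<exists>s>0. q + s *\<^sub>R (v + e *\<^sub>R a) \<in> rel_interior C"
        using U(3) q by (fastforce simp: K_def)
      moreover have "0 < - (\<epsilon> * (w \<bullet> v) / 2)"
        using W(2)[OF v(1)] \<epsilon> by (simp add: mult_pos_neg)
      then have "\<exists>s>0. q + s *\<^sub>R (v + (- (\<epsilon> * (w \<bullet> v) / 2)) *\<^sub>R a) \<in> rel_interior C"
        using v by blast
      then have "\<exists>s>0. q + s *\<^sub>R D \<epsilon> v \<in> rel_interior C"
        by (simp add: D_def)
      ultimately show ?thesis unfolding R_def by blast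
    qed
    moreover have "open (U \<inter> {q. 0 < w0 \<bullet> q})"
      by (intro open_Int U open_halfspace_gt)
    moreover have "x \<in> U \<inter> {q. 0 < w0 \<bullet> q}"
      using U w[OF x True] w0[OF True] by simp
    \<comment> \<open>The bound 1 is arbitrary: on this neighbourhood \<open>R \<epsilon> q\<close>
      holds for every positive \<epsilon>.\<close>
    ultimately show ?thesis
      by (intro exI[of _ 1]) (auto intro!: exI[of _ "U \<inter> {q. 0 < w0 \<bullet> q}"])
  next
    case False
    have x: "x \<in> C" using xK by (auto simp: K_def)
    have nx: "0 < n \<bullet> x" using n[OF x] False by simp
    obtain s where s: "s > 0" "x + s *\<^sub>R y \<in> rel_interior C"
      using B[OF x nx] by blast
    obtain r where r: "r > 0" "ball (x + s *\<^sub>R y) r \<inter> span C \<subseteq> rel_interior C"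
      using rel_interior_convex_cone_ball[OF cc s(2)] .
    \<comment> \<open>\<open>k1\<close> bounds \<open>\<bar>w0 \<bullet> q\<bar>\<close> for unit
      \<open>q\<close>, so the tilt changes \<open>n \<bullet> q\<close> by at most
      \<open>n \<bullet> x / 2\<close>. \<open>k2\<close> bounds, per unit of \<epsilon>, the
      displacement caused by replacing \<open>y\<close> with \<open>d \<epsilon>\<close>. Adding 1
      keeps the divisors positive and the second estimate strict.\<close>
    define k1 where "k1 = norm w0 + 1"
    define k2 where "k2 = s * (w0 \<bullet> y + 1) * norm a + 1"
    have k: "k1 > 0" "k2 > 0"
      using s w0y by (auto simp: k1_def k2_def add_nonneg_pos)
    define e where "e = min ((n \<bullet> x / 2) / k1) ((r / 2) / k2)"
    have e: "e > 0" using nx k r by (simp add: e_def)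
    define U where "U = ball x (r/2) \<inter> {q. n \<bullet> x / 2 < n \<bullet> q}"
    have "R \<epsilon> q" if q: "q \<in> U \<inter> K" and \<epsilon>: "0 < \<epsilon>" "\<epsilon> \<le> e" for q \<epsilon>
    proof -
      have q': "q \<in> C" "norm q = 1" "n \<bullet> x / 2 < n \<bullet> q" "dist x q < r/2"
        using q by (auto simp: U_def K_def)
      have "\<bar>w0 \<bullet> q\<bar> \<le> k1"
        using Cauchy_Schwarz_ineq2[of w0 q] q' by (simp add: k1_def)
      then have "\<epsilon> * \<bar>w0 \<bullet> q\<bar> \<le> \<epsilon> * k1"
        using \<epsilon> by simp
      also have "\<dots> \<le> n \<bullet> x / 2"
        using \<epsilon> k by (simp add: e_def le_divide_eq)
      finally have "\<bar>\<epsilon> * (w0 \<bullet> q)\<bar> \<le> n \<bullet> x / 2"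
        using \<epsilon> by (simp add: abs_mult)
      then have "0 < u \<epsilon> \<bullet> q"
        using q' by (auto simp: u_def inner_simps)
      moreover have "q + s *\<^sub>R d \<epsilon> \<in> rel_interior C"
      proof -
        have "s * (\<epsilon> * (w0 \<bullet> y + 1)) * norm a < \<epsilon> * k2"
          using \<epsilon> by (simp add: k2_def algebra_simps)
        also have "\<dots> \<le> r / 2"
          using \<epsilon> k by (simp add: e_def le_divide_eq)
        finally have "norm ((s * (\<epsilon> * (w0 \<bullet> y + 1))) *\<^sub>R a) < r / 2"
          using s \<epsilon> w0y by (simp add: abs_mult)
        moreover have "norm (x - q) < r / 2" using q' by (simp add: dist_norm)
        ultimately have "norm ((x - q) + (s * (\<epsilon> * (w0 \<bullet> y + 1))) *\<^sub>R a) < r"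
          using norm_triangle_lt[of "x - q" "(s * (\<epsilon> * (w0 \<bullet> y + 1))) *\<^sub>R a" r] by simp
        moreover have "(x + s *\<^sub>R y) - (q + s *\<^sub>R d \<epsilon>) = (x - q) + (s * (\<epsilon> * (w0 \<bullet> y + 1))) *\<^sub>R a"
          by (simp add: d_def algebra_simps)
        ultimately have "q + s *\<^sub>R d \<epsilon> \<in> ball (x + s *\<^sub>R y) r"
          by (simp only: mem_ball dist_norm)
        moreover have "q + s *\<^sub>R d \<epsilon> \<in> span C"
          unfolding d_def using q' y aC by (intro span_add span_diff span_scale) (auto simp: span_base)
        ultimately show ?thesis using r by blast
      qed
      ultimately show ?thesis unfolding R_def using s by blast
    qed
    moreover have "open U"
      unfolding U_def by (intro open_Int open_ball open_halfspace_gt)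
    moreover have "x \<in> U" using r nx by (simp add: U_def)
    ultimately show ?thesis using e by blast
  qed
  then obtain \<epsilon> where \<epsilon>: "\<epsilon> > 0" "\<And>q. q \<in> K \<Longrightarrow> R \<epsilon> q"
    using compact_uniformly_small[OF \<open>compact K\<close>, of R] by blast
  define V where "V = insert (d \<epsilon>) (D \<epsilon> ` W)"
  have "finite V" "card V \<le> Suc (card W)"
    using W by (auto simp: V_def card_image_le intro: le_trans[OF card_insert_le_m1] 
        simp: card_insert_if le_SucI)
  moreover have norml: "x /\<^sub>R norm x \<in> K" if "x \<in> C - {0}" for x
    using that cc by (auto simp: K_def convex_cone_scaleR)
  have "0 < u \<epsilon> \<bullet> x" if "x \<in> C - {0}" for x
  proof -
    have "0 < u \<epsilon> \<bullet> (x /\<^sub>R norm x)"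
      using \<epsilon>(2)[OF norml[OF that]] R_def by blast
    then show ?thesis using that by (simp add: zero_less_divide_iff divide_inverse_commute[symmetric])
  qed
  moreover have "v \<in> span C \<and> u \<epsilon> \<bullet> v < 0" if "v \<in> V" for v
  proof -
    have ua: "u \<epsilon> \<bullet> a = 1" using a w0a by (simp add: u_def inner_simps)
    show ?thesis
    proof (cases "v = d \<epsilon>")
      case True
      have "u \<epsilon> \<bullet> v = - \<epsilon>"
        using ua y unfolding True d_def by (simp add: inner_simps) (simp add: u_def inner_simps algebra_simps)
      moreover have "v \<in> span C"
        unfolding True d_def using y aC by (intro span_diff span_scale) (auto simp: span_base)
      ultimately show ?thesis using \<epsilon> by simp
    next
      case False
      then obtain v' where v': "v' \<in> W" "v = D \<epsilon> v'" using \<open>v \<in> V\<close> by (auto simp: V_def)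
      have "u \<epsilon> \<bullet> v = \<epsilon> * (w \<bullet> v') / 2"
        using ua W(2)[OF v'(1)] w0[of v'] unfolding v' D_def
        by (simp add: inner_simps) (simp add: u_def inner_simps)
      moreover have "v \<in> span C"
        unfolding v' D_def using W(2)[OF v'(1)] aC by (intro span_diff span_scale) auto
      moreover have "\<epsilon> * (w \<bullet> v') < 0"
        using \<epsilon> W(2)[OF v'(1)] by (simp add: mult_pos_neg)
      ultimately show ?thesis by simp
    qed
  qed
  moreover have "\<exists>v\<in>V. \<exists>s>0. q + s *\<^sub>R v \<in> rel_interior C" if q: "q \<in> C - {0}" for q
  proof -
    obtain v s where vs: "v \<in> V" "s > 0" "q /\<^sub>R norm q + s *\<^sub>R v \<in> rel_interior C"
      using \<epsilon>(2)[OF norml[OF q]] unfolding R_def V_def by blast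
    have "norm q *\<^sub>R (q /\<^sub>R norm q + s *\<^sub>R v) \<in> rel_interior C"
      using rel_interior_convex_cone_scaleR[OF cc vs(3)] q by simp
    then have "q + (norm q * s) *\<^sub>R v \<in> rel_interior C"
      using q by (simp add: scaleR_add_right)
    then show ?thesis using vs q by (intro bexI[of _ v] exI[of _ "norm q * s"]) auto
  qed
  ultimately show ?thesis unfolding illuminable_def by blast
qed

lemma illuminable_mono:
  assumes "illuminable C m" "m \<le> k"
  shows "illuminable C k"
proof -
  obtain u V where "finite V" "card V \<le> m" and V: "(\<forall>x\<in>C - {0}. 0 < u \<bullet> x) \<and>
     (\<forall>v\<in>V. v \<in> span C \<and> u \<bullet> v < 0) \<and>
     (\<forall>q\<in>C - {0}. \<exists>v\<in>V. \<exists>s>0. q + s *\<^sub>R v \<in> rel_interior C)"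
    using assms(1) unfolding illuminable_def by blast
  then have "finite V" "card V \<le> k"
    using assms(2) by auto
  with V show ?thesis unfolding illuminable_def by blast
qed

section \<open>Supporting hyperplanes and the facet step\<close>

text \<open>A hyperplane supporting a cone passes through the origin: comparing the minimum at
  \<open>x\<close> with the values at \<open>2 x\<close> and at 0 forces it to be 0.\<close>

lemma convex_cone_supporting_functional:
  fixes C :: "'a::euclidean_space set"
  assumes C: "convex_cone C" and x: "x \<in> C" "x \<notin> rel_interior C"
  obtains n where "n \<bullet> x = 0" "\<And>z. z \<in> C \<Longrightarrow> 0 \<le> n \<bullet> z"
    "\<And>z. z \<in> rel_interior C \<Longrightarrow> 0 < n \<bullet> z"
proof -
  obtain n where n: "\<And>z. z \<in> C \<Longrightarrow> n \<bullet> x \<le> n \<bullet> z" "\<And>z. z \<in> rel_interior C \<Longrightarrow> n \<bullet> x < n \<bullet> z"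
    by (rule supporting_hyperplane_rel_boundary[OF convex_cone_imp_convex[OF C] x]) blast
  have "n \<bullet> x \<le> n \<bullet> (2 *\<^sub>R x)"
    by (rule n(1)[OF convex_cone_scaleR[OF C _ x(1)]]) simp
  moreover have "n \<bullet> x \<le> n \<bullet> 0"
    by (rule n(1)[OF convex_cone_0[OF C]])
  ultimately have nx: "n \<bullet> x = 0" by simp
  show ?thesis
    by (rule that[OF nx]) (use n nx in auto)
qed

lemma rel_interior_convex_cone_nonempty:
  fixes C :: "'a::euclidean_space set"
  assumes "convex_cone C"
  obtains a where "a \<in> rel_interior C" "a \<in> C"
  using assms rel_interior_eq_empty[of C] rel_interior_subset[of C] unfolding convex_cone_def by blast

text \<open>The hyperplane omits \<open>a\<close>, so it cuts the span of \<open>C\<close> down to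
  dimension at most \<open>dim F\<close>, which the span of \<open>F\<close> already fills.\<close>

lemma span_Int_hyperplane_facet:
  fixes C :: "'a::euclidean_space set"
  assumes F: "F \<subseteq> span C" "\<And>z. z \<in> F \<Longrightarrow> n \<bullet> z = 0" "dim C = Suc (dim F)"
    and a: "a \<in> span C" "n \<bullet> a \<noteq> 0"
  shows "span C \<inter> {z. n \<bullet> z = 0} = span F"
proof -
  let ?S = "span C \<inter> {z. n \<bullet> z = 0}"
  have sub: "subspace ?S"
    by (simp add: subspace_inter subspace_hyperplane)
  then have "span F \<subseteq> ?S"
    using F by (intro span_minimal) auto
  moreover have "span ?S \<subset> span C"
    using a by (subst span_eq_iff[THEN iffD2, OF sub]) auto
  then have "dim ?S < dim C" by (rule dim_psubset)
  then have "dim ?S \<le> dim (span F)" using F by simp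
  ultimately show ?thesis
    using subspace_dim_equal[of "span F" ?S] sub by auto
qed

text \<open>Projecting along an interior vector \<open>a\<close> onto the hyperplane of the facet
  reduces everything to \<open>F\<close>: a point with nonnegative \<open>n\<close> whose projection
  lies in \<open>F\<close> belongs to \<open>C\<close>. This is the local half-space structure
  behind hypothesis \<open>A\<close> of \<open>illuminable_lift\<close>.\<close>

lemma illuminable_face:
  fixes C :: "'a::euclidean_space set"
  assumes C: "pointed_cone C" and F: "F face_of C" "F \<noteq> {}" "aff_dim C = aff_dim F + 1"
    and ill: "illuminable F m"
  shows "illuminable C (Suc m)"
proof -
  have cc: "convex_cone C" using C by (simp add: pointed_cone_def)
  have cF: "convex_cone F" using pointed_cone_face[OF C F(1,2)] by (simp add: pointed_cone_def)
  have FC: "F \<subseteq> C" "F \<noteq> C" using F by (auto simp: face_of_imp_subset)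
  \<comment> \<open>Any hyperplane supporting \<open>C\<close> at a relative interior point of
    \<open>F\<close> contains all of \<open>F\<close>. The same point serves as the limit of the
    extra direction.\<close>
  obtain y where y: "y \<in> rel_interior F" "y \<in> F"
    using rel_interior_convex_cone_nonempty[OF cF] .
  have "y \<in> C" "y \<notin> rel_interior C"
    using face_of_disjoint_rel_interior[OF F(1) FC(2)] FC y by auto
  then obtain n where n: "n \<bullet> y = 0" "\<And>z. z \<in> C \<Longrightarrow> 0 \<le> n \<bullet> z"
      "\<And>z. z \<in> rel_interior C \<Longrightarrow> 0 < n \<bullet> z"
    by (rule convex_cone_supporting_functional[OF cc]) blast
  obtain a0 where a0: "a0 \<in> rel_interior C"
    using rel_interior_convex_cone_nonempty[OF cc] .
  define a where "a = a0 /\<^sub>R (n \<bullet> a0)"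
  have a: "a \<in> rel_interior C" "n \<bullet> a = 1"
    using n(3)[OF a0] a0 by (auto simp: a_def rel_interior_convex_cone_scaleR cc)
  have aC: "a \<in> C" using a rel_interior_subset by blast
  define E where "E = C \<inter> {z. n \<bullet> z = 0}"
  have E: "E face_of C"
    unfolding E_def using n cc
    by (intro face_of_Int_supporting_hyperplane_ge convex_cone_imp_convex) auto
  have "F \<subseteq> E"
    using y n FC by (intro subset_of_face_of[OF E]) (auto simp: E_def)
  \<comment> \<open>\<open>F\<close> has codimension one in \<open>C\<close>, which leaves no
    dimension for a face strictly between them.\<close>
  have FE: "F = E"
  proof (rule ccontr)
    assume "F \<noteq> E"
    then have "aff_dim F < aff_dim E"
      using face_of_aff_dim_lt[of E F] face_of_subset[OF F(1) \<open>F \<subseteq> E\<close>] E face_of_imp_convex face_of_imp_subset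
      by blast
    moreover have "a \<notin> E" using a by (simp add: E_def)
    then have "E \<noteq> C" using aC by blast
    then have "aff_dim E < aff_dim C"
      using face_of_aff_dim_lt E cc convex_cone_imp_convex by blast
    ultimately show False using F by linarith
  qed
  have dims: "dim C = Suc (dim F)"
    using F(3) by (simp add: aff_dim_convex_cone cc cF)
  have spanF: "span C \<inter> {z. n \<bullet> z = 0} = span F"
    using FC dims a aC by (intro span_Int_hyperplane_facet[where a = a]) (auto simp: FE E_def span_base)
  define \<pi> where "\<pi> z = z - (n \<bullet> z) *\<^sub>R a" for z
  have \<pi>_span: "\<pi> z \<in> span F" if "z \<in> span C" for z
    unfolding spanF[symmetric] using that aC a
    by (auto simp: \<pi>_def inner_simps span_diff span_scale span_base)
  have in_ri: "z + e *\<^sub>R a \<in> rel_interior C" if "z \<in> C" "0 < e" for z e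
    using rel_interior_convex_cone_add[OF cc rel_interior_convex_cone_scaleR[OF cc a(1) that(2)] that(1)]
    by (simp add: add.commute)
  have in_C: "z \<in> C" if "\<pi> z \<in> F" "0 \<le> n \<bullet> z" for z
  proof -
    have "\<pi> z + (n \<bullet> z) *\<^sub>R a \<in> C"
      using that aC FC cc by (intro convex_cone_add convex_cone_scaleR) auto
    then show ?thesis by (simp add: \<pi>_def)
  qed
  obtain w V where V: "finite V" "card V \<le> m" "\<And>x. x \<in> F \<Longrightarrow> x \<noteq> 0 \<Longrightarrow> 0 < w \<bullet> x"
      "\<And>v. v \<in> V \<Longrightarrow> v \<in> span F \<and> w \<bullet> v < 0"
      "\<And>q. q \<in> F \<Longrightarrow> q \<noteq> 0 \<Longrightarrow> \<exists>v\<in>V. \<exists>s>0. q + s *\<^sub>R v \<in> rel_interior F"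
    using ill unfolding illuminable_def by (metis DiffI singletonD)
  have "illuminable C (Suc (card V))"
  proof (rule illuminable_lift[OF C a n(2) \<open>y \<in> C\<close> n(1) V(1)])
    show "v \<in> span C \<and> n \<bullet> v = 0 \<and> w \<bullet> v < 0" if "v \<in> V" for v
      using V(4)[OF that] spanF by blast
    show "0 < w \<bullet> x" if "x \<in> C" "x \<noteq> 0" "n \<bullet> x = 0" for x
      using V(3)[of x] that by (simp add: FE E_def)
  next
    fix x assume x: "x \<in> C" "x \<noteq> 0" "n \<bullet> x = 0"
    then have "x \<in> F" by (simp add: FE E_def)
    then obtain v s where v: "v \<in> V" "s > 0" "x + s *\<^sub>R v \<in> rel_interior F"
      using V(5) x by blast
    obtain r where r: "r > 0" "ball (x + s *\<^sub>R v) r \<inter> span F \<subseteq> rel_interior F"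
      using rel_interior_convex_cone_ball[OF cF v(3)] .
    \<comment> \<open>\<open>U\<close> is fixed by the projection and a ball around a point of
      \<open>F\<close>; the tilt \<open>e\<close> does not enter.\<close>
    define U where "U = (\<lambda>q. \<pi> q + s *\<^sub>R v) -` ball (x + s *\<^sub>R v) r"
    have "open U"
      unfolding U_def \<pi>_def by (intro open_vimage open_ball continuous_intros)
    moreover have "x \<in> U" using r x by (simp add: U_def \<pi>_def)
    moreover have "\<exists>v\<in>V. \<forall>e>0. \<exists>s>0. q + s *\<^sub>R (v + e *\<^sub>R a) \<in> rel_interior C"
      if q: "q \<in> U \<inter> C" for q
    proof -
      have nv: "n \<bullet> v = 0" "v \<in> span F" using V(4)[OF v(1)] spanF by auto
      have "\<pi> q + s *\<^sub>R v \<in> span F"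
        using \<pi>_span[of q] q nv by (auto intro: span_add span_scale span_base)
      moreover have "\<pi> q + s *\<^sub>R v \<in> ball (x + s *\<^sub>R v) r"
        using q by (simp only: U_def Int_iff vimage_eq)
      ultimately have "\<pi> q + s *\<^sub>R v \<in> F"
        using r rel_interior_subset[of F] by blast
      then have "q + s *\<^sub>R v \<in> C"
        using n(2)[of q] q nv by (intro in_C) (auto simp: \<pi>_def inner_simps algebra_simps)
      then have "q + s *\<^sub>R v + (s * e) *\<^sub>R a \<in> rel_interior C" if "e > 0" for e
        using in_ri v that by simp
      then have "q + s *\<^sub>R (v + e *\<^sub>R a) \<in> rel_interior C" if "e > 0" for e
        using that by (simp add: scaleR_add_right add.assoc)
      then show ?thesis using v by blast
    qed
    ultimately show "\<exists>U. open U \<and> x \<in> U \<and>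
       (\<forall>q\<in>U \<inter> C. \<exists>v\<in>V. \<forall>e>0. \<exists>s>0. q + s *\<^sub>R (v + e *\<^sub>R a) \<in> rel_interior C)" by blast
  next
    fix x assume x: "x \<in> C" "0 < n \<bullet> x"
    \<comment> \<open>A short move from \<open>y\<close> along the projection of \<open>x\<close>
      stays in \<open>F\<close>. After rescaling by \<open>1/s\<close>, restoring the component
      \<open>n \<bullet> x\<close> along \<open>a\<close> gives exactly \<open>x\<close> plus
      \<open>1/s\<close> times \<open>y\<close>.\<close>
    obtain s where s: "s > 0" "y + s *\<^sub>R \<pi> x \<in> rel_interior F"
      using rel_interior_convex_cone_dir[OF cF y(1) \<pi>_span[OF span_base[OF x(1)]]] .
    then have "y + s *\<^sub>R \<pi> x \<in> C" using rel_interior_subset FC by blast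
    then have "(1/s) *\<^sub>R (y + s *\<^sub>R \<pi> x) \<in> C"
      using s by (intro convex_cone_scaleR cc) auto
    then have "(1/s) *\<^sub>R (y + s *\<^sub>R \<pi> x) + (n \<bullet> x) *\<^sub>R a \<in> rel_interior C"
      using in_ri x by blast
    moreover have "(1/s) *\<^sub>R (y + s *\<^sub>R \<pi> x) + (n \<bullet> x) *\<^sub>R a = x + (1/s) *\<^sub>R y"
      using s by (simp add: scaleR_add_right \<pi>_def)
    ultimately show "\<exists>s>0. x + s *\<^sub>R y \<in> rel_interior C"
      using s by (intro exI[of _ "1/s"]) auto
  qed
  then show ?thesis using V by (auto intro: illuminable_mono)
qed

section \<open>Rays and polyhedral cones\<close>

text \<open>With no nonzero point to illuminate, the conditions are vacuous.\<close>

lemma illuminable_zero: "illuminable {0} 0"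
  unfolding illuminable_def by (intro exI[of _ 0] exI[of _ "{}"]) auto

lemma zero_face_of_pointed_cone:
  assumes "pointed_cone C"
  shows "{0} face_of C"
proof -
  obtain w where w: "\<And>x. x \<in> C \<Longrightarrow> x \<noteq> 0 \<Longrightarrow> 0 < w \<bullet> x"
    using assms by (auto simp: pointed_cone_def)
  have C: "convex_cone C" using assms by (simp add: pointed_cone_def)
  have "C \<inter> {x. w \<bullet> x = 0} face_of C"
    using w by (intro face_of_Int_supporting_hyperplane_ge convex_cone_imp_convex[OF C])
      (metis inner_zero_right less_eq_real_def)
  moreover have "C \<inter> {x. w \<bullet> x = 0} = {0}"
    using w convex_cone_0[OF C] by fastforce
  ultimately show ?thesis by simp
qed

lemma illuminable_dim_1:
  assumes "pointed_cone C" "aff_dim C = 1"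
  shows "illuminable C 1"
  using illuminable_face[OF assms(1) zero_face_of_pointed_cone[OF assms(1)] _ _ illuminable_zero] assms(2)
  by simp

text \<open>A polyhedral pointed cone has a full flag of faces, starting at \<open>{0}\<close>.\<close>

lemma illuminable_polyhedron:
  fixes C :: "'a::euclidean_space set"
  assumes "pointed_cone C" "polyhedron C" "aff_dim C = int m"
  shows "illuminable C m"
  using assms
proof (induction m arbitrary: C)
  case 0
  then have "C = {0}"
    by (metis aff_dim_eq_0 convex_cone_0 of_nat_0 pointed_cone_def singletonD)
  then show ?case using illuminable_zero by simp
next
  case (Suc m)
  have cc: "convex_cone C" using Suc.prems by (simp add: pointed_cone_def)
  have 0: "{0} face_of C" "{0} \<noteq> C"
    using zero_face_of_pointed_cone[OF Suc.prems(1)] Suc.prems(3) by auto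
  \<comment> \<open>The apex lies on the relative boundary, which for a polyhedron is the union of
    the facets; hence some facet exists.\<close>
  then have "0 \<in> C - rel_interior C"
    using face_of_disjoint_rel_interior[OF 0] convex_cone_0[OF cc] by auto
  then obtain F where F: "F facet_of C"
    unfolding rel_boundary_of_polyhedron[OF Suc.prems(2)] by blast
  then have F': "F face_of C" "F \<noteq> {}" "aff_dim F = int m"
    using Suc.prems by (auto simp: facet_of_def)
  have "illuminable F m"
    using F' Suc.prems by (intro Suc.IH) (auto intro: pointed_cone_face face_of_polyhedron_polyhedron)
  then show ?case
    using F' Suc.prems by (intro illuminable_face[OF Suc.prems(1)]) auto
qed

section \<open>Boundary rays and cones of dimension two and three\<close>

lemma rel_boundary_proper_face:
  fixes C :: "'a::euclidean_space set"
  assumes C: "convex_cone C" and q: "q \<in> C" "q \<notin> rel_interior C"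
  obtains n where "(C \<inter> {z. n \<bullet> z = 0}) face_of C" "C \<inter> {z. n \<bullet> z = 0} \<noteq> C"
    "\<And>z. z \<in> C \<Longrightarrow> 0 \<le> n \<bullet> z" "\<And>z. z \<in> rel_interior C \<Longrightarrow> 0 < n \<bullet> z" "n \<bullet> q = 0"
proof -
  obtain n where n: "n \<bullet> q = 0" "\<And>z. z \<in> C \<Longrightarrow> 0 \<le> n \<bullet> z" "\<And>z. z \<in> rel_interior C \<Longrightarrow> 0 < n \<bullet> z"
    by (rule convex_cone_supporting_functional[OF C q]) blast
  obtain a where a: "a \<in> rel_interior C" "a \<in> C"
    using rel_interior_convex_cone_nonempty[OF C] .
  have "a \<notin> C \<inter> {z. n \<bullet> z = 0}" using n(3)[OF a(1)] by simp
  then have "C \<inter> {z. n \<bullet> z = 0} \<noteq> C" using a by blast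
  moreover have "(C \<inter> {z. n \<bullet> z = 0}) face_of C"
    using n(2) by (intro face_of_Int_supporting_hyperplane_ge convex_cone_imp_convex[OF C]) auto
  ultimately show ?thesis using that n by blast
qed

text \<open>The walk from a relative interior point \<open>a\<close> along \<open>- b\<close>, with
  \<open>b\<close> in \<open>C\<close> but not a multiple of \<open>a\<close>, is stopped by the
  positive functional. Its last point in \<open>C\<close> is a boundary point, nonzero by the choice
  of \<open>b\<close>.\<close>

lemma pointed_cone_boundary_point:
  fixes C :: "'a::euclidean_space set"
  assumes C: "pointed_cone C" and dim: "2 \<le> dim C"
  obtains q where "q \<in> C" "q \<noteq> 0" "q \<notin> rel_interior C"
proof -
  have cc: "convex_cone C" and cl: "closed C"
    using C by (auto simp: pointed_cone_def)
  obtain w where w: "\<And>x. x \<in> C \<Longrightarrow> x \<noteq> 0 \<Longrightarrow> 0 < w \<bullet> x"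
    using C by (auto simp: pointed_cone_def)
  obtain a where a: "a \<in> rel_interior C" "a \<in> C"
    using rel_interior_convex_cone_nonempty[OF cc] .
  have "{0} \<noteq> C" using dim by auto
  then have a0: "a \<noteq> 0"
    using face_of_disjoint_rel_interior[OF zero_face_of_pointed_cone[OF C]] a by auto
  have "\<not> C \<subseteq> span {a}"
  proof
    assume "C \<subseteq> span {a}"
    then have "dim C \<le> card {a}" by (rule dim_le_card) simp
    then show False using dim by simp
  qed
  then obtain b where b: "b \<in> C" "b \<notin> span {a}" by blast
  then have "b \<noteq> 0" using span_0 by blast
  then have wb: "0 < w \<bullet> b" using w b by blast
  define M where "M = {s. a - s *\<^sub>R b \<in> C}"
  have "M = (\<lambda>s. a - s *\<^sub>R b) -` C" by (auto simp: M_def)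
  then have "closed M"
    using cl by (simp add: closed_vimage continuous_intros)
  have M0: "0 \<in> M" using a by (simp add: M_def)
  have bound: "s \<le> (w \<bullet> a) / (w \<bullet> b)" if "s \<in> M" for s
  proof -
    have "0 \<le> w \<bullet> (a - s *\<^sub>R b)"
      using w[of "a - s *\<^sub>R b"] that by (cases "a - s *\<^sub>R b = 0") (auto simp: M_def)
    then show ?thesis using wb by (simp add: inner_simps pos_le_divide_eq)
  qed
  then have bdd: "bdd_above M" by (rule bdd_aboveI)
  define s where "s = Sup M"
  have "s \<in> M"
    unfolding s_def using closed_contains_Sup[OF _ bdd \<open>closed M\<close>] M0 by blast
  show ?thesis
  proof (rule that)
    show "a - s *\<^sub>R b \<in> C" using \<open>s \<in> M\<close> by (simp add: M_def)
    show "a - s *\<^sub>R b \<noteq> 0"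
    proof
      assume "a - s *\<^sub>R b = 0"
      then have "a = s *\<^sub>R b" by simp
      moreover from this have "s \<noteq> 0" using a0 by auto
      ultimately have "b = (1/s) *\<^sub>R a" by simp
      then show False using b by (simp add: span_scale span_base)
    qed
    show "a - s *\<^sub>R b \<notin> rel_interior C"
    proof
      assume *: "a - s *\<^sub>R b \<in> rel_interior C"
      have "- b \<in> span C" using b by (simp add: span_base span_neg)
      then obtain e where e: "e > 0" "a - s *\<^sub>R b + e *\<^sub>R (- b) \<in> rel_interior C"
        using rel_interior_convex_cone_dir[OF cc *] by metis
      then have "s + e \<in> M"
        using rel_interior_subset by (auto simp: M_def algebra_simps)
      then have "s + e \<le> s" unfolding s_def using bdd by (rule cSup_upper)
      then show False using e by simp
    qed
  qed
qed

text \<open>A supporting hyperplane at a nonzero boundary point cuts out a face of dimension one,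
  from which one facet step leads to \<open>C\<close>.\<close>

lemma illuminable_dim_2:
  fixes C :: "'a::euclidean_space set"
  assumes C: "pointed_cone C" "aff_dim C = 2"
  shows "illuminable C 2"
proof -
  have cc: "convex_cone C" using C by (simp add: pointed_cone_def)
  have "2 \<le> dim C" using aff_dim_convex_cone[OF cc] C by simp
  then obtain q where q: "q \<in> C" "q \<noteq> 0" "q \<notin> rel_interior C"
    using pointed_cone_boundary_point[OF C(1)] by blast
  obtain n where E: "(C \<inter> {z. n \<bullet> z = 0}) face_of C" "C \<inter> {z. n \<bullet> z = 0} \<noteq> C" "n \<bullet> q = 0"
    by (rule rel_boundary_proper_face[OF cc q(1,3)])
  let ?E = "C \<inter> {z. n \<bullet> z = 0}"
  have "aff_dim ?E < 2"
    using face_of_aff_dim_lt[OF convex_cone_imp_convex[OF cc] E(1,2)] C by simp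
  moreover have "{0, q} \<subseteq> ?E" using q E convex_cone_0[OF cc] by auto
  then have "aff_dim {0, q} \<le> aff_dim ?E" by (rule aff_dim_subset)
  then have "1 \<le> aff_dim ?E" using q by simp
  ultimately have 1: "aff_dim ?E = 1" by linarith
  have ne: "?E \<noteq> {}" using q E by auto
  have "illuminable ?E 1"
    by (rule illuminable_dim_1[OF pointed_cone_face[OF C(1) E(1) ne] 1])
  then have "illuminable C (Suc 1)"
    using 1 C(2) by (intro illuminable_face[OF C(1) E(1) ne]) auto
  then show ?thesis by (simp add: numeral_2_eq_2)
qed

lemma span_pair: "z \<in> span {x, y} \<Longrightarrow> \<exists>\<alpha> \<beta>. z = \<alpha> *\<^sub>R x + \<beta> *\<^sub>R y"
  by (auto simp: span_insert span_singleton algebra_simps)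

text \<open>A two-dimensional face permits a facet step. Without one, every proper face is at most a
  ray, so a supporting plane spanned by a boundary ray and a tangent direction meets
  \<open>C\<close> in that ray only. Two directions, one for each side of the ray, then replace
  those inherited from a facet.\<close>

lemma illuminable_dim_3:
  fixes C :: "'a::euclidean_space set"
  assumes C: "pointed_cone C" "aff_dim C = 3"
  shows "illuminable C 3"
proof (cases "\<exists>E. E face_of C \<and> aff_dim E = 2")
  case True
  then obtain E where E: "E face_of C" "aff_dim E = 2" by blast
  then have ne: "E \<noteq> {}" by auto
  have "illuminable C (Suc 2)"
    using illuminable_dim_2[OF pointed_cone_face[OF C(1) E(1) ne] E(2)] E C(2)
    by (intro illuminable_face[OF C(1) E(1) ne]) auto
  then show ?thesis by (simp add: numeral_3_eq_3)
next
  case False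
  have cc: "convex_cone C" using C by (simp add: pointed_cone_def)
  obtain w where w: "\<And>x. x \<in> C \<Longrightarrow> x \<noteq> 0 \<Longrightarrow> 0 < w \<bullet> x"
    using C by (auto simp: pointed_cone_def)
  have dimC: "dim C = 3" using aff_dim_convex_cone[OF cc] C by simp
  have ray: "E \<subseteq> span {q}" if E: "E face_of C" "E \<noteq> C" and q: "q \<in> E" "q \<noteq> 0" for E q
  proof -
    have "aff_dim E < 3"
      using face_of_aff_dim_lt[OF convex_cone_imp_convex[OF cc] E] C by simp
    then have "aff_dim E \<le> 1" using False E by (cases "aff_dim E = 2") auto
    moreover have "convex_cone E"
      using pointed_cone_face[OF C(1) E(1)] q by (auto simp: pointed_cone_def)
    ultimately have "dim E \<le> 1" using aff_dim_convex_cone[of E] by simp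
    then have "dim (span E) \<le> dim (span {q})" using q by simp
    moreover have "span {q} \<subseteq> span E" using q by (intro span_mono) auto
    ultimately have "span {q} = span E" by (intro subspace_dim_equal) auto
    then show ?thesis using span_superset by blast
  qed
  obtain q1 where q1: "q1 \<in> C" "q1 \<noteq> 0" "q1 \<notin> rel_interior C"
    using pointed_cone_boundary_point[OF C(1)] dimC by auto
  obtain n1 where n1: "n1 \<bullet> q1 = 0" "\<And>z. z \<in> rel_interior C \<Longrightarrow> 0 < n1 \<bullet> z"
    by (rule rel_boundary_proper_face[OF cc q1(1,3)]) blast
  define q0 where "q0 = q1 /\<^sub>R norm q1"
  have q0: "q0 \<in> C" "norm q0 = 1" "q0 \<bullet> q0 = 1" "n1 \<bullet> q0 = 0" "q0 \<noteq> 0"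
    using q1 n1 cc by (auto simp: q0_def convex_cone_scaleR dot_square_norm)
  obtain a0 where a0: "a0 \<in> rel_interior C" "a0 \<in> C"
    using rel_interior_convex_cone_nonempty[OF cc] .
  \<comment> \<open>\<open>tang\<close> is the open tangent cone at \<open>q0\<close>, and \<open>t\<close> will be a point of its boundary.\<close>
  define tang where "tang z \<longleftrightarrow> (\<exists>x\<in>rel_interior C. \<exists>r. z = x + r *\<^sub>R q0)" for z
  have tang_add: "tang (z + y)" if z: "tang z" and y: "y \<in> C" for z y
  proof -
    obtain x r where x: "x \<in> rel_interior C" "z = x + r *\<^sub>R q0" using z tang_def by blast
    have "x + y \<in> rel_interior C" by (rule rel_interior_convex_cone_add[OF cc x(1) y])
    moreover have "z + y = (x + y) + r *\<^sub>R q0" using x by simp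
    ultimately show ?thesis unfolding tang_def by blast
  qed
  have tang_shift: "tang (z + k *\<^sub>R q0)" if z: "tang z" for z k
  proof -
    obtain x r where x: "x \<in> rel_interior C" "z = x + r *\<^sub>R q0" using z tang_def by blast
    have "z + k *\<^sub>R q0 = x + (r + k) *\<^sub>R q0" using x by (simp add: scaleR_add_left)
    then show ?thesis unfolding tang_def using x by blast
  qed
  have tang_pos: "0 < n1 \<bullet> z" if z: "tang z" for z
    using z n1(2) q0 by (auto simp: tang_def inner_simps)
  have tang_ri: "\<exists>s>0. l *\<^sub>R q0 + s *\<^sub>R z \<in> rel_interior C" if z: "tang z" and l: "0 < l" for z l
  proof -
    obtain x r where x: "x \<in> rel_interior C" "z = x + r *\<^sub>R q0" using z tang_def by blast
    \<comment> \<open>This choice gives \<open>s * \<bar>r\<bar> \<le> l\<close>, so the coefficient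
      \<open>l + s * r\<close> of \<open>q0\<close> is nonnegative.\<close>
    define s where "s = l / (\<bar>r\<bar> + 1)"
    have s: "s > 0" using l by (simp add: s_def add_nonneg_pos)
    have "s * \<bar>r\<bar> \<le> l"
      using l by (simp add: s_def divide_le_eq mult_left_mono add_nonneg_pos)
    moreover have "- (s * \<bar>r\<bar>) \<le> s * r"
      using s by (metis abs_ge_minus_self abs_mult abs_of_pos minus_le_iff)
    ultimately have "0 \<le> l + s * r" by linarith
    then have "(l + s * r) *\<^sub>R q0 \<in> C" using cc q0 convex_cone_scaleR by blast
    then have "s *\<^sub>R x + (l + s * r) *\<^sub>R q0 \<in> rel_interior C"
      by (intro rel_interior_convex_cone_add[OF cc] rel_interior_convex_cone_scaleR[OF cc] x s)
    moreover have "s *\<^sub>R x + (l + s * r) *\<^sub>R q0 = l *\<^sub>R q0 + s *\<^sub>R z"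
      by (simp add: x algebra_simps)
    ultimately show ?thesis using s by auto
  qed
  \<comment> \<open>Since \<open>C\<close> spans three dimensions, some \<open>c\<close> lies
    outside the plane of \<open>q0\<close> and \<open>a0\<close>; this keeps \<open>t\<close> from
    vanishing.\<close>
  have "\<not> span C \<subseteq> span {q0, a0}"
  proof
    assume "span C \<subseteq> span {q0, a0}"
    then have "C \<subseteq> span {q0, a0}" using span_superset by blast
    then have "dim C \<le> card {q0, a0}" by (rule dim_le_card) simp
    then show False using dimC card_insert_le_m1[of 2 "{a0}" q0] by simp
  qed
  then obtain c where c: "c \<in> span C" "c \<notin> span {q0, a0}" by blast
  have n1a: "0 < n1 \<bullet> a0" using n1 a0 by blast
  \<comment> \<open>The line through \<open>c\<close> in direction \<open>a0\<close> lies in the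
    open tangent cone for large \<mu> and, as \<open>n1\<close> shows, outside it for small \<mu>.
    The infimum marks the boundary point \<open>t1\<close>.\<close>
  define M where "M = {\<mu>. tang (c + \<mu> *\<^sub>R a0)}"
  obtain s0 where s0: "s0 > 0" "a0 + s0 *\<^sub>R c \<in> rel_interior C"
    using rel_interior_convex_cone_dir[OF cc a0(1) c(1)] .
  have "(1/s0) *\<^sub>R (a0 + s0 *\<^sub>R c) \<in> rel_interior C"
    using s0 by (intro rel_interior_convex_cone_scaleR[OF cc]) auto
  moreover have "(1/s0) *\<^sub>R (a0 + s0 *\<^sub>R c) = c + (1/s0) *\<^sub>R a0"
    using s0 by (simp add: scaleR_add_right)
  ultimately have "tang (c + (1/s0) *\<^sub>R a0)"
    unfolding tang_def by (metis add.right_neutral scaleR_zero_left)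
  then have M_ne: "M \<noteq> {}" by (auto simp: M_def)
  have "- (n1 \<bullet> c) / (n1 \<bullet> a0) \<le> \<mu>" if "\<mu> \<in> M" for \<mu>
  proof -
    have "0 < n1 \<bullet> c + \<mu> * (n1 \<bullet> a0)"
      using tang_pos[of "c + \<mu> *\<^sub>R a0"] that by (simp add: M_def inner_simps)
    then show ?thesis by (intro pos_divide_le_eq[OF n1a, THEN iffD2]) linarith
  qed
  then have M_bdd: "bdd_below M" by (rule bdd_belowI)
  define t1 where "t1 = c + Inf M *\<^sub>R a0"
  \<comment> \<open>Shifts along \<open>q0\<close> preserve \<open>tang\<close>, so making the
    vector orthogonal to \<open>q0\<close> keeps it on the boundary of the tangent cone.\<close>
  define t where "t = t1 - (t1 \<bullet> q0) *\<^sub>R q0"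
  have tang_t: "tang (t + e *\<^sub>R a0)" if e: "e > 0" for e
  proof -
    obtain \<mu> where \<mu>: "\<mu> \<in> M" "\<mu> < Inf M + e"
      using cInf_lessD[OF M_ne, of "Inf M + e"] e by auto
    have "tang ((c + \<mu> *\<^sub>R a0) + (Inf M + e - \<mu>) *\<^sub>R a0)"
    proof (rule tang_add)
      show "tang (c + \<mu> *\<^sub>R a0)" using \<mu> by (simp add: M_def)
      show "(Inf M + e - \<mu>) *\<^sub>R a0 \<in> C" using \<mu> a0 cc by (intro convex_cone_scaleR) auto
    qed
    moreover have "(c + \<mu> *\<^sub>R a0) + (Inf M + e - \<mu>) *\<^sub>R a0 = t1 + e *\<^sub>R a0"
      by (simp add: t1_def algebra_simps)
    ultimately have "tang (t1 + e *\<^sub>R a0 + (- (t1 \<bullet> q0)) *\<^sub>R q0)"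
      using tang_shift by metis
    moreover have "t1 + e *\<^sub>R a0 + (- (t1 \<bullet> q0)) *\<^sub>R q0 = t + e *\<^sub>R a0"
      by (simp add: t_def)
    ultimately show ?thesis by (simp only:)
  qed
  have not_tang_t: "\<not> tang t"
  proof
    assume "tang t"
    then have "tang (t + (t1 \<bullet> q0) *\<^sub>R q0)" by (rule tang_shift)
    then have "tang t1" by (simp add: t_def)
    then obtain x r where x: "x \<in> rel_interior C" "t1 = x + r *\<^sub>R q0" using tang_def by blast
    have "- a0 \<in> span C" using a0 by (simp add: span_base span_neg)
    then obtain e where e: "e > 0" "x + e *\<^sub>R (- a0) \<in> rel_interior C"
      using rel_interior_convex_cone_dir[OF cc x(1)] by metis
    have "c + (Inf M - e) *\<^sub>R a0 = (x + e *\<^sub>R (- a0)) + r *\<^sub>R q0"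
      using x(2) by (simp add: t1_def algebra_simps)
    then have "tang (c + (Inf M - e) *\<^sub>R a0)"
      unfolding tang_def using e by blast
    then have "Inf M - e \<in> M" by (simp add: M_def)
    then have "Inf M \<le> Inf M - e" using M_bdd by (rule cInf_lower)
    then show False using e by simp
  qed
  have tq: "t \<bullet> q0 = 0" using q0 by (simp add: t_def inner_simps)
  have tC: "t \<in> span C" "q0 \<in> span C" "a0 \<in> span C"
  proof -
    show q: "q0 \<in> span C" and a: "a0 \<in> span C" using q0 a0 by (auto intro: span_base)
    show "t \<in> span C"
      unfolding t_def t1_def by (intro span_diff span_add span_scale c(1) q a)
  qed
  have t0: "t \<noteq> 0"
  proof
    assume "t = 0"
    then have "t1 = (t1 \<bullet> q0) *\<^sub>R q0" unfolding t_def by (simp only: right_minus_eq)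
    moreover have "c = t1 - Inf M *\<^sub>R a0" by (simp add: t1_def)
    ultimately have "c = (t1 \<bullet> q0) *\<^sub>R q0 - Inf M *\<^sub>R a0" by (simp only:)
    moreover have "(t1 \<bullet> q0) *\<^sub>R q0 - Inf M *\<^sub>R a0 \<in> span {q0, a0}" by (intro span_diff span_scale span_base) auto
    ultimately show False using c(2) by metis
  qed
  \<comment> \<open>For positive \<beta> such a point would put \<open>t\<close> into the open
    tangent cone. Otherwise \<open>n1\<close> is negative at \<open>t\<close>, although
    \<open>t\<close> is a limit of tangent vectors, on which \<open>n1\<close> is positive.\<close>
  have not_ri: "\<alpha> *\<^sub>R q0 + \<beta> *\<^sub>R t \<notin> rel_interior C" for \<alpha> \<beta>
  proof
    assume *: "\<alpha> *\<^sub>R q0 + \<beta> *\<^sub>R t \<in> rel_interior C"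
    have pos: "0 < \<beta> * (n1 \<bullet> t)" using n1(2)[OF *] q0 by (simp add: inner_simps)
    show False
    proof (cases "\<beta> > 0")
      case True
      then have "(1/\<beta>) *\<^sub>R (\<alpha> *\<^sub>R q0 + \<beta> *\<^sub>R t) \<in> rel_interior C"
        by (intro rel_interior_convex_cone_scaleR[OF cc *]) simp
      moreover have "t = (1/\<beta>) *\<^sub>R (\<alpha> *\<^sub>R q0 + \<beta> *\<^sub>R t) + (- \<alpha> / \<beta>) *\<^sub>R q0"
        using True by (simp add: scaleR_add_right)
      ultimately have "tang t" unfolding tang_def by blast
      then show False using not_tang_t by blast
    next
      case False
      then have neg: "n1 \<bullet> t < 0" using pos by (simp add: zero_less_mult_iff)
      then have "tang (t + (- (n1 \<bullet> t) / (n1 \<bullet> a0)) *\<^sub>R a0)"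
        using n1a by (intro tang_t) (simp add: divide_neg_pos)
      then have "0 < n1 \<bullet> (t + (- (n1 \<bullet> t) / (n1 \<bullet> a0)) *\<^sub>R a0)" by (rule tang_pos)
      then show False using n1a by (simp add: inner_simps)
    qed
  qed
  note span_qt = span_pair[of _ q0 t]
  have "q0 \<notin> span {t}"
  proof
    assume "q0 \<in> span {t}"
    then obtain k where "q0 = k *\<^sub>R t" using span_singleton[of t] by blast
    then have "q0 \<bullet> q0 = (k *\<^sub>R t) \<bullet> q0" by (rule arg_cong)
    then show False using tq q0 by simp
  qed
  then have dim2: "dim {q0, t} = 2" using t0 by (simp add: dim_insert)
  have "span {q0, t} \<subseteq> span C" using tC by (intro span_minimal) auto
  moreover have "span {q0, t} \<noteq> span C" using dim2 dimC by (metis dim_span numeral_eq_iff semiring_norm(89))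
  ultimately obtain n0 where n0: "n0 \<noteq> 0" "n0 \<in> span C" "\<And>y. y \<in> span {q0, t} \<Longrightarrow> orthogonal n0 y"
    using orthogonal_to_subspace_exists_gen[of "{q0, t}" C] by blast
  have n0L: "span C \<inter> {z. n0 \<bullet> z = 0} = span {q0, t}"
    using n0 dimC dim2 tC
    by (intro span_Int_hyperplane_facet[where a = n0]) (auto simp: orthogonal_def span_base)
  have n0a: "n0 \<bullet> a0 \<noteq> 0"
  proof
    assume "n0 \<bullet> a0 = 0"
    then have "a0 \<in> span {q0, t}" using n0L tC by blast
    then show False using span_qt not_ri a0 by metis
  qed
  define n where "n = n0 /\<^sub>R (n0 \<bullet> a0)"
  have na: "n \<bullet> a0 = 1" using n0a by (simp add: n_def)
  have nL: "z \<in> span {q0, t}" if "z \<in> span C" "n \<bullet> z = 0" for z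
    using that n0L n0a by (auto simp: n_def)
  have nq: "n \<bullet> q0 = 0" "n \<bullet> t = 0"
    using n0(3)[of q0] n0(3)[of t] by (auto simp: n_def orthogonal_def span_base)
  have in_ri: "z + e *\<^sub>R a0 \<in> rel_interior C" if "z \<in> C" "0 < e" for z e
    using rel_interior_convex_cone_add[OF cc rel_interior_convex_cone_scaleR[OF cc a0(1) that(2)] that(1)]
    by (simp add: add.commute)
  have n_nonneg: "0 \<le> n \<bullet> x" if x: "x \<in> C" for x
  proof (rule ccontr)
    assume "\<not> 0 \<le> n \<bullet> x"
    \<comment> \<open>Pushing \<open>x\<close> along \<open>a0\<close> until \<open>n\<close>
      vanishes would land in the relative interior and in the plane of \<open>q0\<close> and
      \<open>t\<close> at once.\<close>
    then have *: "x + (- (n \<bullet> x)) *\<^sub>R a0 \<in> rel_interior C" by (intro in_ri x) simp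
    have "n \<bullet> (x + (- (n \<bullet> x)) *\<^sub>R a0) = 0" using na by (simp add: inner_simps)
    moreover have "x + (- (n \<bullet> x)) *\<^sub>R a0 \<in> span C"
      using x tC by (intro span_add span_scale) (auto simp: span_base)
    ultimately show False using nL span_qt not_ri * by metis
  qed
  have E: "\<exists>l>0. x = l *\<^sub>R q0" if x: "x \<in> C" "x \<noteq> 0" "n \<bullet> x = 0" for x
  proof -
    have "a0 \<notin> C \<inter> {z. n \<bullet> z = 0}" using na by simp
    then have "C \<inter> {z. n \<bullet> z = 0} \<noteq> C" using a0 by blast
    moreover have "(C \<inter> {z. n \<bullet> z = 0}) face_of C"
      using n_nonneg by (intro face_of_Int_supporting_hyperplane_ge convex_cone_imp_convex[OF cc]) auto
    ultimately have "C \<inter> {z. n \<bullet> z = 0} \<subseteq> span {q0}"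
      using q0 nq by (intro ray) auto
    then obtain l where l: "x = l *\<^sub>R q0" using x span_singleton[of q0] by blast
    have "0 < w \<bullet> q0" "0 < w \<bullet> x" using w q0 x by auto
    then have "0 < l" using l by (simp add: zero_less_mult_iff)
    then show ?thesis using l by blast
  qed
  define \<pi> where "\<pi> z = z - (n \<bullet> z) *\<^sub>R a0" for z
  \<comment> \<open>Near the ray through \<open>q0\<close> a point is \<open>\<rho> q0 + \<xi> t + \<eta> a0\<close> with \<open>\<bar>\<xi>\<bar> < \<rho>\<close>; moving by \<open>\<bar>\<xi>\<bar> (\<plusminus> t - q0)\<close>
    cancels the \<open>t\<close>-component and leaves a point of \<open>C\<close>.\<close>
  have "illuminable C (Suc (card {t - q0, - t - q0}))"
  proof (rule illuminable_lift[OF C(1) a0(1) na n_nonneg q0(1) nq(1), where w = q0])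
    fix v assume "v \<in> {t - q0, - t - q0}"
    then show "v \<in> span C \<and> n \<bullet> v = 0 \<and> q0 \<bullet> v < 0"
      using tC nq tq q0 by (auto simp: inner_simps inner_commute span_diff span_neg)
  next
    fix x assume "x \<in> C" "x \<noteq> 0" "n \<bullet> x = 0"
    then show "0 < q0 \<bullet> x" using E q0 by fastforce
  next
    fix x assume x: "x \<in> C" "0 < n \<bullet> x"
    \<comment> \<open>Otherwise a supporting hyperplane at \<open>x + q0\<close> contains both
      \<open>x\<close> and \<open>q0\<close>. Its face is a ray, so \<open>x\<close> is a multiple
      of \<open>q0\<close>, against \<open>0 < n \<bullet> x\<close>.\<close>
    have "x + q0 \<in> rel_interior C"
    proof (rule ccontr)
      assume *: "x + q0 \<notin> rel_interior C"
      have "x + q0 \<in> C" using x q0 cc convex_cone_add by blast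
      from rel_boundary_proper_face[OF cc this *] obtain n2 where
        n2: "(C \<inter> {z. n2 \<bullet> z = 0}) face_of C" "C \<inter> {z. n2 \<bullet> z = 0} \<noteq> C"
        "\<And>z. z \<in> C \<Longrightarrow> 0 \<le> n2 \<bullet> z" "n2 \<bullet> (x + q0) = 0" by metis
      then have "n2 \<bullet> x = 0" "n2 \<bullet> q0 = 0"
        using n2(3)[OF x(1)] n2(3)[OF q0(1)] by (auto simp: inner_simps)
      then have "x \<in> span {q0}"
        using ray[OF n2(1,2), of q0] q0 x by auto
      then obtain k where "x = k *\<^sub>R q0" using span_singleton[of q0] by blast
      then show False using x nq by simp
    qed
    then show "\<exists>s>0. x + s *\<^sub>R q0 \<in> rel_interior C"
      by (intro exI[of _ 1]) simp
  next
    fix x assume x: "x \<in> C" "x \<noteq> 0" "n \<bullet> x = 0"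
    then obtain l where l: "l > 0" "x = l *\<^sub>R q0" using E by blast
    \<comment> \<open>As \<open>t\<close> and the unit vector \<open>q0\<close> are orthogonal, the
      two expressions are the coefficients of \<open>t\<close> and \<open>q0\<close> in
      \<open>\<pi> q\<close>.\<close>
    define U where "U = {q. \<bar>t \<bullet> \<pi> q / (t \<bullet> t)\<bar> < q0 \<bullet> \<pi> q}"
    have "open U"
      unfolding U_def \<pi>_def by (intro open_Collect_less continuous_intros) (use t0 in auto)
    moreover have "x \<in> U"
      using l nq tq q0 by (simp add: U_def \<pi>_def inner_simps)
    moreover have "\<exists>v\<in>{t - q0, - t - q0}. \<forall>e>0. \<exists>s>0. q + s *\<^sub>R (v + e *\<^sub>R a0) \<in> rel_interior C"
      if q: "q \<in> U \<inter> C" for q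
    proof -
      have qC: "q \<in> C" "q \<in> span C" using q by (auto simp: span_base)
      have "\<pi> q \<in> span C" "n \<bullet> \<pi> q = 0"
        using qC tC na by (auto simp: \<pi>_def inner_simps intro!: span_diff span_scale)
      then obtain \<rho> \<xi> where \<pi>q: "\<pi> q = \<rho> *\<^sub>R q0 + \<xi> *\<^sub>R t" using nL span_qt by metis
      then have "t \<bullet> \<pi> q / (t \<bullet> t) = \<xi>" and \<rho>_eq: "q0 \<bullet> \<pi> q = \<rho>"
        using \<pi>q t0 tq q0 by (simp_all add: inner_simps inner_commute)
      moreover have "\<bar>t \<bullet> \<pi> q / (t \<bullet> t)\<bar> < q0 \<bullet> \<pi> q" using q unfolding U_def by blast
      ultimately have \<rho>: "\<bar>\<xi>\<bar> < \<rho>" by metis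
      have qeq: "q = \<rho> *\<^sub>R q0 + \<xi> *\<^sub>R t + (n \<bullet> q) *\<^sub>R a0"
        using \<pi>q by (simp add: \<pi>_def algebra_simps)
      consider "n \<bullet> q = 0" | "0 < n \<bullet> q" "\<xi> = 0" | "0 < n \<bullet> q" "\<xi> < 0" | "0 < n \<bullet> q" "0 < \<xi>"
        using n_nonneg[OF qC(1)] by linarith
      then show ?thesis
      proof cases
        case 1
        \<comment> \<open>On the ray \<xi> = 0, so a cancelling move would have length 0. Instead
          the tilted direction itself lies in the open tangent cone at \<open>q0\<close>.\<close>
        have "q \<noteq> 0" using \<rho> \<rho>_eq by (auto simp: \<pi>_def)
        then obtain k where k: "k > 0" "q = k *\<^sub>R q0" using E qC 1 by blast
        have "\<exists>s>0. q + s *\<^sub>R (t - q0 + e *\<^sub>R a0) \<in> rel_interior C" if "e > 0" for e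
        proof -
          have "tang (t + e *\<^sub>R a0 + (-1) *\<^sub>R q0)" by (intro tang_shift tang_t that)
          then have "tang (t - q0 + e *\<^sub>R a0)" by (simp add: algebra_simps)
          then show ?thesis unfolding k(2) using tang_ri k(1) by blast
        qed
        then show ?thesis by blast
      next
        case 2
        then have "q \<in> rel_interior C"
          using in_ri[of "\<rho> *\<^sub>R q0" "n \<bullet> q"] qeq \<rho> q0 cc by (simp add: convex_cone_scaleR)
        moreover have "t - q0 + e *\<^sub>R a0 \<in> span C" for e
          using tC by (intro span_add span_diff span_scale)
        ultimately have "\<exists>s>0. q + s *\<^sub>R (t - q0 + e *\<^sub>R a0) \<in> rel_interior C" for e
          using rel_interior_convex_cone_dir[OF cc] by metis
        then show ?thesis by blast
      next
        case 3
        have "\<exists>s>0. q + s *\<^sub>R (t - q0 + e *\<^sub>R a0) \<in> rel_interior C" if "e > 0" for e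
        proof -
          have "(\<rho> + \<xi>) *\<^sub>R q0 \<in> C" using \<rho> q0 cc by (intro convex_cone_scaleR) auto
          moreover have "\<xi> * e < 0" using 3 that by (simp add: mult_neg_pos)
          then have "0 < n \<bullet> q - \<xi> * e" using 3 by linarith
          ultimately have "(\<rho> + \<xi>) *\<^sub>R q0 + (n \<bullet> q - \<xi> * e) *\<^sub>R a0 \<in> rel_interior C" by (rule in_ri)
          moreover have "(\<rho> + \<xi>) *\<^sub>R q0 + (n \<bullet> q - \<xi> * e) *\<^sub>R a0 = q + (- \<xi>) *\<^sub>R (t - q0 + e *\<^sub>R a0)"
            by (subst qeq) (simp add: algebra_simps)
          ultimately show ?thesis using 3 by (intro exI[of _ "- \<xi>"]) auto
        qed
        then show ?thesis by blast
      next
        case 4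
        have "\<exists>s>0. q + s *\<^sub>R (- t - q0 + e *\<^sub>R a0) \<in> rel_interior C" if "e > 0" for e
        proof -
          have "(\<rho> - \<xi>) *\<^sub>R q0 \<in> C" using \<rho> q0 cc by (intro convex_cone_scaleR) auto
          moreover have "0 < n \<bullet> q + \<xi> * e" using 4 that by (simp add: add_pos_pos)
          ultimately have "(\<rho> - \<xi>) *\<^sub>R q0 + (n \<bullet> q + \<xi> * e) *\<^sub>R a0 \<in> rel_interior C" by (rule in_ri)
          moreover have "(\<rho> - \<xi>) *\<^sub>R q0 + (n \<bullet> q + \<xi> * e) *\<^sub>R a0 = q + \<xi> *\<^sub>R (- t - q0 + e *\<^sub>R a0)"
            by (subst qeq) (simp add: algebra_simps)
          ultimately show ?thesis using 4 by (intro exI[of _ "\<xi>"]) auto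
        qed
        then show ?thesis by blast
      qed
    qed
    ultimately show "\<exists>U. open U \<and> x \<in> U \<and> (\<forall>q\<in>U \<inter> C. \<exists>v\<in>{t - q0, - t - q0}.
        \<forall>e>0. \<exists>s>0. q + s *\<^sub>R (v + e *\<^sub>R a0) \<in> rel_interior C)" by blast
  qed auto
  moreover have "card {t - q0, - t - q0} \<le> 2" by (simp add: card_insert_if)
  ultimately show ?thesis by (auto intro: illuminable_mono)
qed

section \<open>The cone over a spherically convex set\<close>

text \<open>Radial projection ignores positive factors, so the coefficients may be rescaled to sum
  to 1.\<close>

lemma sph_segment_combination:
  assumes "0 \<le> \<alpha>" "0 \<le> \<beta>" "0 < \<alpha> + \<beta>"
  shows "sgn (\<alpha> *\<^sub>R p + \<beta> *\<^sub>R q) \<in> sph_segment p q"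
proof -
  define t where "t = \<beta> / (\<alpha> + \<beta>)"
  have t: "0 \<le> t" "t \<le> 1" "1 - t = \<alpha> / (\<alpha> + \<beta>)"
    using assms by (auto simp: t_def field_simps)
  have "\<alpha> *\<^sub>R p + \<beta> *\<^sub>R q = (\<alpha> + \<beta>) *\<^sub>R ((1 - t) *\<^sub>R p + t *\<^sub>R q)"
    unfolding t(3) using assms by (simp add: t_def scaleR_add_right)
  then have "sgn (\<alpha> *\<^sub>R p + \<beta> *\<^sub>R q) = sgn ((1 - t) *\<^sub>R p + t *\<^sub>R q)"
    using assms by (simp add: sgn_scaleR)
  then show ?thesis
    unfolding sph_segment_def closed_segment_def using t by blast
qed

lemma sph_open_segment_combination:
  assumes "0 < \<alpha>" "0 < \<beta>" "p \<noteq> q"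
  shows "sgn (\<alpha> *\<^sub>R p + \<beta> *\<^sub>R q) \<in> sph_open_segment p q"
proof -
  define t where "t = \<beta> / (\<alpha> + \<beta>)"
  have t: "0 < t" "t < 1" "1 - t = \<alpha> / (\<alpha> + \<beta>)"
    using assms by (auto simp: t_def field_simps)
  have "\<alpha> *\<^sub>R p + \<beta> *\<^sub>R q = (\<alpha> + \<beta>) *\<^sub>R ((1 - t) *\<^sub>R p + t *\<^sub>R q)"
    unfolding t(3) using assms by (simp add: t_def scaleR_add_right)
  then have "sgn (\<alpha> *\<^sub>R p + \<beta> *\<^sub>R q) = sgn ((1 - t) *\<^sub>R p + t *\<^sub>R q)"
    using assms by (simp add: sgn_scaleR)
  moreover have "(1 - t) *\<^sub>R p + t *\<^sub>R q \<in> open_segment p q"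
    using t assms by (auto simp: in_segment)
  ultimately show ?thesis
    unfolding sph_open_segment_def by (metis image_eqI)
qed

lemma endpoints_in_sph_segment:
  assumes "norm p = 1" "norm q = 1"
  shows "p \<in> sph_segment p q" "q \<in> sph_segment p q"
  using sph_segment_combination[of 1 0 p q] sph_segment_combination[of 0 1 p q] assms
  by (simp_all add: sgn_div_norm)

lemma mem_conic_hull_iff:
  fixes K :: "'a::euclidean_space set"
  assumes "K \<subseteq> usphere" "K \<noteq> {}"
  shows "x \<in> conic hull K \<longleftrightarrow> x = 0 \<or> sgn x \<in> K"
proof
  assume "x \<in> conic hull K"
  then obtain c k where ck: "x = c *\<^sub>R k" "0 \<le> c" "k \<in> K"
    by (auto simp: conic_hull_explicit)
  moreover have "norm k = 1" using ck assms by auto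
  ultimately show "x = 0 \<or> sgn x \<in> K"
    by (cases "c = 0") (auto simp: sgn_div_norm)
next
  assume *: "x = 0 \<or> sgn x \<in> K"
  show "x \<in> conic hull K"
  proof (cases "x = 0")
    case True
    then show ?thesis using assms by simp
  next
    case False
    then have "x = norm x *\<^sub>R sgn x" by (simp add: sgn_div_norm)
    then show ?thesis using * False unfolding conic_hull_explicit
      by (metis (mono_tags, lifting) mem_Collect_eq norm_ge_zero)
  qed
qed

lemma mem_conic_hull_unit:
  fixes K :: "'a::euclidean_space set"
  assumes "K \<subseteq> usphere" "K \<noteq> {}" "norm x = 1"
  shows "x \<in> conic hull K \<longleftrightarrow> x \<in> K"
  using mem_conic_hull_iff[OF assms(1,2), of x] assms(3) by (auto simp: sgn_div_norm)

lemma sph_convex_hemisphere: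
  assumes "sph_convex K"
  obtains a where "K \<subseteq> usphere" "\<And>x. x \<in> K \<Longrightarrow> 0 < a \<bullet> x"
  using assms unfolding sph_convex_def open_hemisphere_def by blast

text \<open>The sum of two nonzero vectors of the cone projects into the spherical segment between
  their directions, so spherical convexity gives closure under addition.\<close>

lemma convex_cone_conic_hull:
  fixes K :: "'a::euclidean_space set"
  assumes K: "sph_convex K" "K \<noteq> {}"
  shows "convex_cone (conic hull K)"
  unfolding convex_cone_iff
proof (intro conjI ballI allI impI)
  obtain a where sub: "K \<subseteq> usphere"
    using sph_convex_hemisphere[OF K(1)] .
  note mem = mem_conic_hull_iff[OF sub K(2)]
  show "0 \<in> conic hull K" using K by simp
  show "c *\<^sub>R x \<in> conic hull K" if "x \<in> conic hull K" "0 \<le> c" for x c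
    using that conic_conic_hull conic_mul by blast
  show "x + y \<in> conic hull K" if xy: "x \<in> conic hull K" "y \<in> conic hull K" for x y
  proof (cases "x = 0 \<or> y = 0")
    case True
    then show ?thesis using xy by auto
  next
    case False
    then have s: "sgn x \<in> K" "sgn y \<in> K" using xy mem by auto
    then have "sph_segment (sgn x) (sgn y) \<subseteq> K" using K unfolding sph_convex_def by blast
    moreover have "sgn (norm x *\<^sub>R sgn x + norm y *\<^sub>R sgn y) \<in> sph_segment (sgn x) (sgn y)"
      using False by (intro sph_segment_combination) (auto simp: add_pos_pos)
    moreover have "norm x *\<^sub>R sgn x + norm y *\<^sub>R sgn y = x + y"
      using False by (simp add: sgn_div_norm)
    ultimately show ?thesis using mem by auto
  qed
qed

lemma conic_hull_pos:
  fixes K :: "'a::euclidean_space set"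
  assumes "K \<subseteq> usphere" "K \<noteq> {}" "\<And>x. x \<in> K \<Longrightarrow> 0 < a \<bullet> x" "x \<in> conic hull K" "x \<noteq> 0"
  shows "0 < a \<bullet> x"
proof -
  have "0 < a \<bullet> sgn x" using assms mem_conic_hull_iff by blast
  then show ?thesis using assms(5) by (simp add: sgn_div_norm zero_less_divide_iff divide_inverse_commute[symmetric])
qed

lemma pointed_cone_conic_hull:
  fixes K :: "'a::euclidean_space set"
  assumes K: "sph_convex K" "K \<noteq> {}" "compact K"
  shows "pointed_cone (conic hull K)"
proof -
  obtain a where a: "K \<subseteq> usphere" "\<And>x. x \<in> K \<Longrightarrow> 0 < a \<bullet> x"
    by (rule sph_convex_hemisphere[OF K(1)]) blast
  have "0 \<notin> K" using a by auto
  then have "closed (conic hull K)" using K by (intro closed_conic_hull) auto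
  then show ?thesis
    unfolding pointed_cone_def using convex_cone_conic_hull[OF K(1,2)] conic_hull_pos[OF a(1) K(2) a(2)]
    by blast
qed

text \<open>Radial projection is continuous away from 0, so the cone over a relatively open subset
  of the sphere is open once the apex is removed.\<close>

lemma sph_interior_conic_hull:
  fixes K :: "'a::euclidean_space set"
  assumes sub: "K \<subseteq> usphere" and ne: "K \<noteq> {}"
  shows "sph_interior K = usphere \<inter> interior (conic hull K)"
proof (intro equalityI subsetI)
  fix x assume "x \<in> sph_interior K"
  then obtain T where T: "openin (top_of_set usphere) T" "x \<in> T" "T \<subseteq> K"
    unfolding sph_interior_def interior_of_def by blast
  then obtain U where U: "open U" "T = usphere \<inter> U" by (auto simp: openin_open)
  have x: "x \<in> usphere" "x \<in> U" using T U by auto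
  define W where "W = (- {0}) \<inter> sgn -` U"
  have "continuous_on (- {0::'a}) sgn"
    unfolding sgn_div_norm by (intro continuous_intros) auto
  then have "open W"
    unfolding W_def using U by (intro continuous_open_preimage) auto
  moreover have "W \<subseteq> conic hull K"
  proof
    fix y assume y: "y \<in> W"
    then have "sgn y \<in> usphere \<inter> U" by (auto simp: W_def norm_sgn)
    then show "y \<in> conic hull K" using U T mem_conic_hull_iff[OF sub ne] by auto
  qed
  moreover have "x \<in> W" using x by (auto simp: W_def sgn_div_norm)
  ultimately show "x \<in> usphere \<inter> interior (conic hull K)"
    using x interior_maximal by blast
next
  fix x assume x: "x \<in> usphere \<inter> interior (conic hull K)"
  have "openin (top_of_set usphere) (usphere \<inter> interior (conic hull K))"
    by (simp add: openin_open_Int)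
  moreover have "usphere \<inter> interior (conic hull K) \<subseteq> K"
    using interior_subset mem_conic_hull_unit[OF sub ne] by force
  ultimately show "x \<in> sph_interior K"
    using x unfolding sph_interior_def interior_of_def by blast
qed

lemma sph_boundary_conic_hull:
  fixes K :: "'a::euclidean_space set"
  assumes "K \<subseteq> usphere" "K \<noteq> {}" "compact K"
  shows "sph_boundary K = K - interior (conic hull K)"
proof -
  have "closedin (top_of_set usphere) K"
    using assms by (intro closed_subset compact_imp_closed)
  then have "top_of_set usphere closure_of K = K" by (rule closure_of_closedin)
  then show ?thesis
    using assms sph_interior_conic_hull[OF assms(1,2)]
    unfolding sph_boundary_def frontier_of_def sph_interior_def by auto
qed

text \<open>A body has a full-dimensional cone, which turns the relative interior in
  \<open>illuminable\<close> into the interior.\<close>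

lemma sph_convex_bodyD:
  fixes K :: "'a::euclidean_space set"
  assumes "sph_convex_body K"
  shows "K \<subseteq> usphere" "K \<noteq> {}" "compact K" "pointed_cone (conic hull K)"
    "interior (conic hull K) \<noteq> {}" "rel_interior (conic hull K) = interior (conic hull K)"
    "span (conic hull K) = UNIV" "aff_dim (conic hull K) = DIM('a)"
proof -
  show ne: "K \<noteq> {}"
    using assms unfolding sph_convex_body_def sph_interior_def
    by (metis interior_of_empty)
  obtain a where "K \<subseteq> usphere"
    by (rule sph_convex_hemisphere[of K]) (use assms in \<open>auto simp: sph_convex_body_def\<close>)
  then show sub: "K \<subseteq> usphere" .
  show "compact K" using assms by (simp add: sph_convex_body_def)
  show *: "pointed_cone (conic hull K)"
    using assms ne by (auto simp: sph_convex_body_def intro: pointed_cone_conic_hull)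
  show int: "interior (conic hull K) \<noteq> {}"
    using assms sph_interior_conic_hull[OF sub ne] by (auto simp: sph_convex_body_def)
  show "rel_interior (conic hull K) = interior (conic hull K)"
    using int by (rule rel_interior_nonempty_interior)
  show "span (conic hull K) = UNIV"
    using affine_hull_convex_cone[of "conic hull K"] affine_hull_nonempty_interior[OF int] *
    by (auto simp: pointed_cone_def)
  show "aff_dim (conic hull K) = DIM('a)"
    using int by (rule aff_dim_nonempty_interior)
qed

text \<open>Radial projection sends an open segment between nonzero points of the cone either to one
  point or to an open spherical segment with distinct, non-antipodal endpoints. The spherical face
  condition handles the latter.\<close>

lemma face_of_conic_hull:
  fixes K :: "'a::euclidean_space set"
  assumes K: "sph_convex K" and F: "sph_face F K" "F \<noteq> {}"
  shows "(conic hull F) face_of (conic hull K)"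
proof -
  have FK: "F \<subseteq> K" and cF: "sph_convex F" using F by (auto simp: sph_face_def)
  have ne: "K \<noteq> {}" using FK F by auto
  obtain h where h: "K \<subseteq> usphere" "\<And>x. x \<in> K \<Longrightarrow> 0 < h \<bullet> x"
    by (rule sph_convex_hemisphere[OF K(1)]) blast
  have Fsub: "F \<subseteq> usphere" using FK h by auto
  note memK = mem_conic_hull_iff[OF h(1) ne] and memF = mem_conic_hull_iff[OF Fsub F(2)]
  show ?thesis
    unfolding face_of_def
  proof (intro conjI ballI impI)
    show "conic hull F \<subseteq> conic hull K" using FK by (rule hull_mono)
    show "convex (conic hull F)"
      using convex_cone_conic_hull[OF cF F(2)] by (rule convex_cone_imp_convex)
    have *: "a \<in> conic hull F \<and> b \<in> conic hull F"
      if ab: "a \<in> conic hull K" "b \<in> conic hull K" "x \<in> conic hull F" "x \<in> open_segment a b"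
      for a b x
    proof -
      obtain t where t: "0 < t" "t < 1" "x = (1 - t) *\<^sub>R a + t *\<^sub>R b" "a \<noteq> b"
        using ab(4) by (auto simp: in_segment)
      consider "a = 0" | "b = 0" | "a \<noteq> 0" "b \<noteq> 0" by blast
      then show ?thesis
      proof cases
        \<comment> \<open>If one endpoint is the apex, \<open>x\<close> is a positive multiple of
          the other, and both project to the same point.\<close>
        case 1
        then have "x = t *\<^sub>R b" "x \<noteq> 0" using t by auto
        then have "sgn b = sgn x" using t by (simp add: sgn_scaleR)
        then show ?thesis using 1 ab memF \<open>x \<noteq> 0\<close> F by simp
      next
        case 2
        then have "x = (1 - t) *\<^sub>R a" "x \<noteq> 0" using t by auto
        then have "sgn a = sgn x" using t by (simp add: sgn_scaleR)
        then show ?thesis using 2 ab memF \<open>x \<noteq> 0\<close> F by simp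
      next
        case 3
        have pos: "0 < h \<bullet> a" "0 < h \<bullet> b"
          using conic_hull_pos[OF h(1) ne h(2)] ab 3 by auto
        have "0 < h \<bullet> x"
          unfolding t(3) using t pos by (simp add: inner_simps add_pos_pos)
        then have "sgn x \<in> F" using ab memF by fastforce
        have s: "sgn a \<in> K" "sgn b \<in> K" using ab memK 3 by auto
        have xs: "x = ((1 - t) * norm a) *\<^sub>R sgn a + (t * norm b) *\<^sub>R sgn b"
        proof -
          have "norm a *\<^sub>R sgn a = a" "norm b *\<^sub>R sgn b = b"
            using 3 by (simp_all add: sgn_div_norm)
          then show ?thesis using t by (simp flip: scaleR_scaleR)
        qed
        show ?thesis
        proof (cases "sgn a = sgn b")
          case True
          have "x = ((1 - t) * norm a + t * norm b) *\<^sub>R sgn a"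
            using xs True by (simp add: scaleR_add_left)
          moreover have "0 < (1 - t) * norm a + t * norm b"
            using t 3 by (simp add: add_pos_pos)
          moreover have "sgn (sgn a) = sgn a" using 3 by (simp add: sgn_div_norm[of "sgn a"] norm_sgn)
          ultimately have "sgn x = sgn a" by (simp add: sgn_scaleR)
          then show ?thesis using True \<open>sgn x \<in> F\<close> memF by simp
        next
          case False
          have "sgn x \<in> sph_open_segment (sgn a) (sgn b)"
            unfolding xs using t 3 False by (intro sph_open_segment_combination) auto
          moreover have "sgn a \<noteq> - sgn b"
          proof
            assume "sgn a = - sgn b"
            then show False using h(2)[OF s(1)] h(2)[OF s(2)] by simp
          qed
          moreover have "sph_segment (sgn a) (sgn b) \<subseteq> K"
            using K s unfolding sph_convex_def by blast
          ultimately have "sph_segment (sgn a) (sgn b) \<subseteq> F"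
            using F(1) s h(1) \<open>sgn x \<in> F\<close> unfolding sph_face_def by blast
          moreover have "norm (sgn a) = 1" "norm (sgn b) = 1" using 3 by (simp_all add: norm_sgn)
          ultimately show ?thesis
            using endpoints_in_sph_segment[of "sgn a" "sgn b"] memF by blast
        qed
      qed
    qed
    show "a \<in> conic hull F" if "a \<in> conic hull K" "b \<in> conic hull K" "x \<in> conic hull F" "x \<in> open_segment a b" for a b x
      using * that by blast
    show "b \<in> conic hull F" if "a \<in> conic hull K" "b \<in> conic hull K" "x \<in> conic hull F" "x \<in> open_segment a b" for a b x
      using * that by blast
  qed
qed

text \<open>Greatspheres correspond to nonzero subspaces, so the smallest one containing
  \<open>F\<close> is cut out by \<open>span F\<close>. The cone therefore has one dimension more
  than the spherical dimension.\<close>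

lemma has_sph_dim_conic_hull:
  fixes F :: "'a::euclidean_space set"
  assumes F: "has_sph_dim F k" "sph_convex F" and k: "0 < k"
  shows "F \<noteq> {}" "aff_dim (conic hull F) = int k + 1"
proof -
  obtain L where L: "subspace L" "dim L = k + 1" "F \<subseteq> usphere \<inter> L"
    and min: "\<And>j G'. greatsphere j G' \<Longrightarrow> F \<subseteq> G' \<Longrightarrow> usphere \<inter> L \<subseteq> G'"
    using F(1) unfolding has_sph_dim_def greatsphere_def by metis
  have sub: "L \<subseteq> M" if M: "subspace M" "dim M > 0" "F \<subseteq> M" for M
  proof
    fix x assume x: "x \<in> L"
    show "x \<in> M"
    proof (cases "x = 0")
      case True
      then show ?thesis using M subspace_0 by blast
    next
      case False
      have "greatsphere (dim M - 1) (usphere \<inter> M)"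
        unfolding greatsphere_def using M by auto
      then have "usphere \<inter> L \<subseteq> usphere \<inter> M" using min M L by blast
      moreover have "sgn x \<in> usphere \<inter> L"
        using x False L(1) by (simp add: norm_sgn sgn_div_norm subspace_scale)
      ultimately have "norm x *\<^sub>R sgn x \<in> M" using M by (intro subspace_scale) auto
      then show ?thesis using False by (simp add: sgn_div_norm)
    qed
  qed
  show ne: "F \<noteq> {}"
  proof
    assume "F = {}"
    \<comment> \<open>For empty \<open>F\<close>, minimality would place \<open>L\<close> inside a
      line, although its dimension \<open>k + 1\<close> exceeds 1.\<close>
    obtain b :: 'a where b: "b \<in> Basis" using nonempty_Basis by blast
    have "dim (span {b}) = 1" using b by auto
    then have "L \<subseteq> span {b}" using \<open>F = {}\<close> by (intro sub) auto
    then have "dim L \<le> dim (span {b})" by (rule dim_subset)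
    then show False using L k \<open>dim (span {b}) = 1\<close> by simp
  qed
  have "dim F > 0"
  proof -
    have "\<not> F \<subseteq> {0}" using L(3) ne by auto
    then show ?thesis by (metis dim_eq_0 gr0I)
  qed
  then have "L \<subseteq> span F" by (intro sub) (auto simp: span_superset)
  moreover have "span F \<subseteq> L" using L by (intro span_minimal) auto
  ultimately have "dim F = k + 1" using L by (metis dim_span subset_antisym)
  moreover have "conic hull F \<subseteq> span F"
    by (intro hull_minimal span_superset) simp
  then have "dim (conic hull F) = dim F"
    by (metis dim_eq_span dim_span hull_subset span_eq span_superset order_trans)
  ultimately show "aff_dim (conic hull F) = int k + 1"
    using aff_dim_convex_cone[OF convex_cone_conic_hull[OF F(2) ne]] by simp
qed

section \<open>From directions to light sources: the upper bound\<close>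

lemma interior_conic_hull_sgn:
  fixes K :: "'a::euclidean_space set"
  assumes K: "sph_convex_body K" and x: "x \<in> interior (conic hull K)" "x \<noteq> 0"
  shows "sgn x \<in> sph_interior K"
proof -
  note D = sph_convex_bodyD[OF K]
  have "sgn x \<in> rel_interior (conic hull K)"
    unfolding sgn_div_norm using x D(4,6)
    by (intro rel_interior_convex_cone_scaleR) (auto simp: pointed_cone_def)
  then show ?thesis
    using sph_interior_conic_hull[OF D(1,2)] D(6) x by (simp add: norm_sgn)
qed

text \<open>The great circle meets the interior in the direction of
  \<open>y = q - \<sigma> p\<close>. An interior point on the segment from \<open>p\<close> to
  \<open>q\<close> would, combined with \<open>y\<close>, make \<open>q\<close> itself
  interior.\<close>

lemma illuminates_point_direction:
  fixes K :: "'a::euclidean_space set"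
  assumes K: "sph_convex_body K" and u: "\<And>x. x \<in> conic hull K \<Longrightarrow> x \<noteq> 0 \<Longrightarrow> 0 < u \<bullet> x"
    and p: "u \<bullet> p = 0" and q: "q \<in> sph_boundary K"
    and \<sigma>: "0 < \<sigma>" "q - \<sigma> *\<^sub>R p \<in> interior (conic hull K)"
  shows "illuminates_point K p q"
proof -
  note D = sph_convex_bodyD[OF K]
  define C where "C = conic hull K"
  have cc: "convex_cone C" and ri: "rel_interior C = interior C"
    using D by (auto simp: C_def pointed_cone_def)
  have qK: "q \<in> K" "q \<notin> interior C"
    using q sph_boundary_conic_hull[OF D(1-3)] by (auto simp: C_def)
  have qC: "q \<in> C" "q \<noteq> 0" "norm q = 1"
    using qK D(1) by (auto simp: C_def hull_inc)
  have uq: "0 < u \<bullet> q" using u qC by (simp add: C_def)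
  define y where "y = q - \<sigma> *\<^sub>R p"
  have y: "y \<in> interior C" using \<sigma> by (simp add: y_def C_def)
  then have "y \<in> C" using interior_subset by blast
  have uy: "u \<bullet> y = u \<bullet> q" using p by (simp add: y_def inner_simps)
  then have y0: "y \<noteq> 0" using uq by auto
  show ?thesis
    unfolding illuminates_point_def
  proof (intro conjI)
    show "q \<noteq> - p" using p uq by auto
    show "sph_segment p q \<inter> sph_interior K = {}"
    proof (rule ccontr)
      assume "sph_segment p q \<inter> sph_interior K \<noteq> {}"
      then obtain t where t: "0 \<le> t" "t \<le> 1" "sgn ((1 - t) *\<^sub>R p + t *\<^sub>R q) \<in> sph_interior K"
        by (auto simp: sph_segment_def closed_segment_def)
      define z where "z = (1 - t) *\<^sub>R p + t *\<^sub>R q"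
      have sz: "sgn z \<in> usphere" "sgn z \<in> interior C"
        using t(3) sph_interior_conic_hull[OF D(1,2)] by (auto simp: z_def C_def)
      then have z0: "z \<noteq> 0" by auto
      then have "norm z *\<^sub>R sgn z \<in> rel_interior C"
        using sz cc by (intro rel_interior_convex_cone_scaleR) (auto simp: ri)
      then have z: "z \<in> rel_interior C" using z0 by (simp add: sgn_div_norm)
      then have "0 < u \<bullet> z" using u z0 rel_interior_subset by (auto simp: C_def)
      then have t0: "0 < t" using p t uq by (cases "t = 0") (auto simp: z_def inner_simps)
      \<comment> \<open>These coefficients cancel \<open>p\<close> and leave a positive multiple of
        \<open>q\<close>.\<close>
      have "\<sigma> *\<^sub>R z + (1 - t) *\<^sub>R y \<in> rel_interior C"
        using z \<sigma> t \<open>y \<in> C\<close>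
        by (intro rel_interior_convex_cone_add[OF cc] rel_interior_convex_cone_scaleR[OF cc]
            convex_cone_scaleR[OF cc]) auto
      moreover define k where "k = \<sigma> * t + (1 - t)"
      moreover have "\<sigma> *\<^sub>R z + (1 - t) *\<^sub>R y = k *\<^sub>R q"
        by (simp add: z_def y_def k_def algebra_simps)
      ultimately have "k *\<^sub>R q \<in> rel_interior C" by simp
      moreover have "0 < k"
        unfolding k_def using \<sigma> t t0 by (simp add: add_pos_nonneg)
      ultimately have "q \<in> rel_interior C"
        using rel_interior_convex_cone_scaleR[OF cc, of "k *\<^sub>R q" "1 / k"] by simp
      then show False using qK ri by simp
    qed
    have "sgn y \<in> span {p, q}"
      unfolding sgn_div_norm y_def by (intro span_scale span_diff span_base) auto
    moreover have "sgn y \<in> usphere" using y0 by (simp add: norm_sgn)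
    ultimately show "greatcircle p q \<inter> sph_interior K \<noteq> {}"
      using interior_conic_hull_sgn[OF K] y y0 unfolding greatcircle_def C_def by blast
  qed
qed

lemma illumination_number_le:
  fixes K :: "'a::euclidean_space set"
  assumes K: "sph_convex_body K" and ill: "illuminable (conic hull K) m" and dim: "2 \<le> DIM('a)"
  shows "illumination_number K \<le> enat m"
proof -
  note D = sph_convex_bodyD[OF K]
  define C where "C = conic hull K"
  have cc: "convex_cone C" and ri: "rel_interior C = interior C" and span: "span C = UNIV"
    using D by (auto simp: C_def pointed_cone_def)
  obtain u V where V: "finite V" "card V \<le> m" "\<And>x. x \<in> C \<Longrightarrow> x \<noteq> 0 \<Longrightarrow> 0 < u \<bullet> x"
      "\<And>v. v \<in> V \<Longrightarrow> u \<bullet> v < 0"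
      "\<And>q. q \<in> C \<Longrightarrow> q \<noteq> 0 \<Longrightarrow> \<exists>v\<in>V. \<exists>s>0. q + s *\<^sub>R v \<in> rel_interior C"
    using ill unfolding illuminable_def C_def by (metis DiffI singletonD)
  have KC: "x \<in> C" "x \<noteq> 0" "0 < u \<bullet> x" if "x \<in> K" for x
  proof -
    show "x \<in> C" "x \<noteq> 0" using that D(1) by (auto simp: C_def hull_inc)
    then show "0 < u \<bullet> x" by (rule V(3))
  qed
  obtain k where k: "k \<in> K" using D by blast
  then have u0: "u \<noteq> 0" using KC by fastforce
  obtain a where a: "a \<in> rel_interior C" "a \<in> C"
    using rel_interior_convex_cone_nonempty[OF cc] .
  have ua: "0 < u \<bullet> a"
  proof (rule rel_interior_pos[OF cc a(1)])
    show "0 \<le> u \<bullet> x" if "x \<in> C" for x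
      using V(3)[OF that] by (cases "x = 0") auto
    show "k \<in> span C" by (simp add: span)
    show "u \<bullet> k \<noteq> 0" using KC[OF k] by simp
  qed
  \<comment> \<open>Sliding \<open>v\<close> along \<open>a\<close> into the hyperplane
    \<open>u = 0\<close> adds a positive multiple of \<open>a\<close> when
    \<open>u \<bullet> v < 0\<close>, which preserves illumination.\<close>
  define f where "f v = v - ((u \<bullet> v) / (u \<bullet> a)) *\<^sub>R a" for v
  have uf: "u \<bullet> f v = 0" for v using ua by (simp add: f_def inner_simps)
  define S where "S = (\<lambda>v. - sgn (f v)) ` {v \<in> V. f v \<noteq> 0}"
  define G where "G = usphere \<inter> {x. u \<bullet> x = 0}"
  have "finite S" using V by (simp add: S_def)
  have "card S \<le> card {v \<in> V. f v \<noteq> 0}" unfolding S_def using V by (intro card_image_le) auto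
  also have "\<dots> \<le> card V" using V by (intro card_mono) auto
  finally have "card S \<le> m" using V by simp
  have "S \<subseteq> G" by (auto simp: S_def G_def norm_sgn sgn_div_norm uf)
  have GK: "G \<inter> K = {}" using KC by (fastforce simp: G_def)
  have "greatsphere (DIM('a) - 2) G"
    unfolding greatsphere_def G_def using dim u0
    by (intro exI[of _ "{x. u \<bullet> x = 0}"]) (simp add: subspace_hyperplane dim_hyperplane)
  have "illuminates K S"
    unfolding illuminates_def
  proof (intro conjI ballI)
    show "S \<subseteq> usphere - K" using \<open>S \<subseteq> G\<close> GK by (auto simp: G_def)
    fix q assume q: "q \<in> sph_boundary K"
    then have qK: "q \<in> K" "q \<notin> interior C"
      using sph_boundary_conic_hull[OF D(1-3)] by (auto simp: C_def)
    obtain v s where v: "v \<in> V" "s > 0" "q + s *\<^sub>R v \<in> rel_interior C"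
      using V(5) KC[OF qK(1)] by blast
    have "0 \<le> s * (- (u \<bullet> v) / (u \<bullet> a))"
      using v V(4)[OF v(1)] ua by (intro mult_nonneg_nonneg divide_nonneg_pos) auto
    then have "q + s *\<^sub>R v + (s * (- (u \<bullet> v) / (u \<bullet> a))) *\<^sub>R a \<in> rel_interior C"
      using a by (intro rel_interior_convex_cone_add[OF cc v(3)] convex_cone_scaleR[OF cc])
    then have int: "q + s *\<^sub>R f v \<in> interior C"
      by (simp add: f_def algebra_simps ri)
    have f0: "f v \<noteq> 0" using int qK by auto
    then have "- sgn (f v) \<in> S" using v by (auto simp: S_def)
    moreover have "illuminates_point K (- sgn (f v)) q"
    proof (rule illuminates_point_direction[OF K _ _ q, where u = u and \<sigma> = "s * norm (f v)"])
      show "0 < u \<bullet> x" if "x \<in> conic hull K" "x \<noteq> 0" for x using V(3) that by (simp add: C_def)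
      show "u \<bullet> - sgn (f v) = 0" by (simp add: sgn_div_norm uf)
      show "0 < s * norm (f v)" using v f0 by simp
      have "(s * norm (f v)) *\<^sub>R (- sgn (f v)) = - (s *\<^sub>R f v)" using f0 by (simp add: sgn_div_norm)
      then show "q - (s * norm (f v)) *\<^sub>R (- sgn (f v)) \<in> interior (conic hull K)"
        using int by (simp add: C_def)
    qed
    ultimately show "\<exists>p\<in>S. illuminates_point K p q" by blast
  qed
  then have "illumination_number K \<le> enat (card S)"
    unfolding illumination_number_def using \<open>finite S\<close> \<open>S \<subseteq> G\<close> GK \<open>greatsphere (DIM('a) - 2) G\<close>
    by (intro INF_lower) blast
  also have "\<dots> \<le> enat m" using \<open>card S \<le> m\<close> by simp
  finally show ?thesis .
qed

section \<open>The lower bound\<close>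

text \<open>With one source \<open>p0\<close> set aside, fewer than \<open>dim L\<close> remain, so
  \<open>L\<close> contains a nonzero vector orthogonal to all of those in \<open>L\<close>. Its
  sign is chosen to suit \<open>p0\<close>.\<close>

lemma subspace_nonneg_functional:
  fixes L :: "'a::euclidean_space set"
  assumes L: "subspace L" and S: "finite S" "card S \<le> dim L" and d: "0 < dim L"
  obtains m where "m \<in> L" "m \<noteq> 0" "\<And>p. p \<in> S \<Longrightarrow> p \<in> L \<Longrightarrow> 0 \<le> m \<bullet> p"
proof -
  obtain p0 T where T: "S \<subseteq> insert p0 T" "finite T" "card T < dim L"
  proof (cases "S = {}")
    case True
    then show ?thesis using that[of 0 "{}"] d by simp
  next
    case False
    then obtain p where "p \<in> S" by blast
    then show ?thesis using that[of p "S - {p}"] S d by fastforce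
  qed
  have "dim (T \<inter> L) < dim L"
    using T dim_le_card'[of "T \<inter> L"] card_mono[of T "T \<inter> L"] by simp
  moreover have "span (T \<inter> L) \<subseteq> span L" by (intro span_mono) simp
  ultimately have "span (T \<inter> L) \<subset> span L" by (metis dim_span order_less_irrefl psubsetI)
  then obtain m where m: "m \<noteq> 0" "m \<in> span L" "\<And>y. y \<in> span (T \<inter> L) \<Longrightarrow> orthogonal m y"
    using orthogonal_to_subspace_exists_gen by blast
  define m' where "m' = (if 0 \<le> m \<bullet> p0 then m else - m)"
  have "m' \<in> span L" "m' \<noteq> 0" using m by (auto simp: m'_def span_neg)
  moreover have "span L = L" using L by (simp add: span_eq_iff)
  moreover have "0 \<le> m' \<bullet> p" if p: "p \<in> S" "p \<in> L" for p
  proof (cases "p = p0")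
    case True
    then show ?thesis by (simp add: m'_def)
  next
    case False
    then have "p \<in> span (T \<inter> L)" using p T by (auto intro: span_base)
    then show ?thesis using m(3) by (auto simp: m'_def orthogonal_def)
  qed
  ultimately show ?thesis using that by simp
qed

text \<open>With too few sources, a functional \<open>m\<close> is nonnegative on all of them.
  Adding a multiple of \<open>u\<close> leaves \<open>m\<close> unchanged on \<open>L\<close> and
  gives \<open>n\<close>, supporting \<open>K\<close> at some \<open>q\<close>. An interior point on
  a great circle through a source and \<open>q\<close> must have positive coefficients at both, so
  it lies on their segment and blocks the light.\<close>

lemma card_illuminates_ge:
  fixes K :: "'a::euclidean_space set"
  assumes K: "sph_convex_body K" and dim: "2 \<le> DIM('a)" and S: "finite S" "illuminates K S"
    and G: "greatsphere (DIM('a) - 2) G" "G \<inter> K = {}" "S \<subseteq> G"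
  shows "DIM('a) \<le> card S"
proof (rule ccontr)
  assume "\<not> DIM('a) \<le> card S"
  note D = sph_convex_bodyD[OF K]
  define C where "C = conic hull K"
  have cc: "convex_cone C" and ri: "rel_interior C = interior C" and span: "span C = UNIV"
    using D by (auto simp: C_def pointed_cone_def)
  note mem = mem_conic_hull_iff[OF D(1,2), folded C_def]
  obtain h where h: "\<And>x. x \<in> C \<Longrightarrow> x \<noteq> 0 \<Longrightarrow> 0 < h \<bullet> x"
    using D(4) by (auto simp: pointed_cone_def C_def)
  have KC: "x \<in> C" "x \<noteq> 0" if "x \<in> K" for x
    using that D(1) by (auto simp: C_def hull_inc)
  obtain L where L: "subspace L" "dim L = DIM('a) - 1" "G = usphere \<inter> L"
    using G(1) dim by (auto simp: greatsphere_def)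
  obtain u0 where u0: "u0 \<noteq> 0" "L = {x. u0 \<bullet> x = 0}"
    using lowdim_eq_hyperplane[of L] L dim by (metis span_eq_iff One_nat_def)
  have nz: "u0 \<bullet> x \<noteq> 0" if "x \<in> K" for x
    using that G(2) D(1) u0 L(3) by auto
  \<comment> \<open>If \<open>u0\<close> took both signs on \<open>K\<close>, a positive combination
    of two points would project to a point of \<open>K\<close> in \<open>G\<close>.\<close>
  have same: "0 < u0 \<bullet> y" if x: "x \<in> K" "0 < u0 \<bullet> x" and y: "y \<in> K" for x y
  proof (rule ccontr)
    assume "\<not> 0 < u0 \<bullet> y"
    then have neg: "u0 \<bullet> y < 0" using nz[OF y] by simp
    define z where "z = (u0 \<bullet> x) *\<^sub>R y + (- (u0 \<bullet> y)) *\<^sub>R x"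
    have "z \<in> C"
      unfolding z_def using x y KC neg cc by (intro convex_cone_add convex_cone_scaleR) auto
    have "0 < h \<bullet> x" "0 < h \<bullet> y" using h KC x y by auto
    then have "0 < (u0 \<bullet> x) * (h \<bullet> y)" "0 < (- (u0 \<bullet> y)) * (h \<bullet> x)"
      using x neg by (intro mult_pos_pos; simp)+
    then have "0 < h \<bullet> z" by (simp add: z_def inner_simps)
    then have "z \<noteq> 0" by auto
    then have "sgn z \<in> K" using \<open>z \<in> C\<close> mem by blast
    moreover have "u0 \<bullet> z = 0" by (simp add: z_def inner_simps)
    then have "u0 \<bullet> sgn z = 0" by (simp add: sgn_div_norm)
    ultimately show False using nz by blast
  qed
  obtain k where k: "k \<in> K" using D by blast
  define u where "u = (if 0 < u0 \<bullet> k then u0 else - u0)"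
  have u: "0 < u \<bullet> x" if "x \<in> K" for x
  proof (cases "0 < u0 \<bullet> k")
    case True
    then show ?thesis using same[OF k True that] by (simp add: u_def)
  next
    case False
    then have "\<not> 0 < u0 \<bullet> x" using same[OF that _ k] by blast
    then show ?thesis using False nz[OF that] by (simp add: u_def)
  qed
  have uL: "u \<noteq> 0" "L = {x. u \<bullet> x = 0}" using u0 by (auto simp: u_def)
  obtain m where m: "m \<in> L" "m \<noteq> 0" "\<And>p. p \<in> S \<Longrightarrow> p \<in> L \<Longrightarrow> 0 \<le> m \<bullet> p"
    by (rule subspace_nonneg_functional[OF L(1) S(1)])
      (use \<open>\<not> DIM('a) \<le> card S\<close> L(2) dim in auto)
  \<comment> \<open>The maximum of this quotient is the least \<open>c\<close> for which
    \<open>m + c u\<close> is nonnegative on \<open>K\<close>; it is attained at the contact point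
    \<open>q\<close>.\<close>
  have "continuous_on K (\<lambda>x. - (m \<bullet> x) / (u \<bullet> x))"
    by (intro continuous_intros) (use u in fastforce)
  then obtain q where q: "q \<in> K" "\<And>x. x \<in> K \<Longrightarrow> - (m \<bullet> x) / (u \<bullet> x) \<le> - (m \<bullet> q) / (u \<bullet> q)"
    using continuous_attains_sup[OF D(3,2)] by blast
  define c where "c = - (m \<bullet> q) / (u \<bullet> q)"
  define n where "n = m + c *\<^sub>R u"
  have nq: "n \<bullet> q = 0" using u[OF q(1)] by (simp add: n_def c_def inner_simps)
  have nK: "0 \<le> n \<bullet> x" if "x \<in> K" for x
    using q(2)[OF that] u[OF that] unfolding c_def[symmetric]
    by (simp add: n_def inner_simps pos_minus_divide_le_eq pos_divide_le_eq)
  have nC: "0 \<le> n \<bullet> x" if "x \<in> C" for x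
    using that nK by (auto simp: C_def conic_hull_explicit)
  \<comment> \<open>\<open>m\<close> lies in \<open>L\<close> and is thus orthogonal to
    \<open>u\<close>, so the two terms cannot cancel.\<close>
  have n0: "n \<noteq> 0"
  proof
    assume "n = 0"
    then have "u \<bullet> n = 0" by simp
    then have "c * (u \<bullet> u) = 0" using m(1) uL by (simp add: n_def inner_simps)
    then have "c = 0" using uL by simp
    then show False using \<open>n = 0\<close> m by (simp add: n_def)
  qed
  have pos: "0 < n \<bullet> x" if "x \<in> interior C" for x
    using that n0 by (intro rel_interior_pos[OF cc _ nC, of _ n]) (auto simp: ri span)
  then have "q \<in> sph_boundary K"
    using q(1) nq sph_boundary_conic_hull[OF D(1-3)] by (fastforce simp: C_def)
  then obtain p where p: "p \<in> S" "sph_segment p q \<inter> sph_interior K = {}"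
      "greatcircle p q \<inter> sph_interior K \<noteq> {}"
    using S(2) unfolding illuminates_def illuminates_point_def by blast
  have pL: "p \<in> L" using p G L by auto
  obtain x where x: "x \<in> sph_interior K" "norm x = 1" "x \<in> span {p, q}"
    using p(3) by (auto simp: greatcircle_def)
  have xC: "x \<in> interior C"
    using x(1) sph_interior_conic_hull[OF D(1,2)] by (simp add: C_def)
  obtain \<alpha> where "x - \<alpha> *\<^sub>R p \<in> span {q}" using x(3) span_insert[of p "{q}"] by blast
  then obtain \<beta> where "x - \<alpha> *\<^sub>R p = \<beta> *\<^sub>R q" using span_singleton[of q] by blast
  then have x\<alpha>: "x = \<alpha> *\<^sub>R p + \<beta> *\<^sub>R q" by (simp add: algebra_simps)
  have "x \<in> C" "x \<noteq> 0" using xC interior_subset x(2) by auto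
  then have "sgn x \<in> K" using mem by blast
  then have "0 < u \<bullet> x" using u[of "sgn x"] x(2) by (simp add: sgn_div_norm)
  \<comment> \<open>\<open>u\<close> vanishes at \<open>p\<close> and isolates \<beta>; below,
    \<open>n\<close> vanishes at \<open>q\<close> and isolates \<alpha>.\<close>
  then have "0 < \<beta> * (u \<bullet> q)" using pL uL by (simp add: x\<alpha> inner_simps)
  then have "0 < \<beta>" using u[OF q(1)] by (simp add: zero_less_mult_iff)
  have "0 < \<alpha> * (n \<bullet> p)" using pos[OF xC] nq by (simp add: x\<alpha> inner_simps)
  moreover have "n \<bullet> p = m \<bullet> p" using pL uL by (simp add: n_def inner_simps)
  ultimately have "0 < \<alpha>" using m(3)[OF p(1) pL] by (simp add: zero_less_mult_iff)
  have "sgn x \<in> sph_segment p q"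
    unfolding x\<alpha> using \<open>0 < \<alpha>\<close> \<open>0 < \<beta>\<close> by (intro sph_segment_combination) auto
  moreover have "sgn x = x" using x(2) by (simp add: sgn_div_norm)
  ultimately show False using x(1) p(2) by auto
qed

lemma illumination_number_ge:
  fixes K :: "'a::euclidean_space set"
  assumes "sph_convex_body K" "2 \<le> DIM('a)"
  shows "enat (DIM('a)) \<le> illumination_number K"
  unfolding illumination_number_def
proof (rule INF_greatest)
  fix S :: "'a set"
  assume "S \<in> {S. finite S \<and> illuminates K S \<and>
    (\<exists>G. greatsphere (DIM('a) - 2) G \<and> G \<inter> K = {} \<and> S \<subseteq> G)}"
  then have "DIM('a) \<le> card S" using card_illuminates_ge[OF assms, of S] by blast
  then show "enat (DIM('a)) \<le> enat (card S)" by simp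
qed

section \<open>Bodies with a flag, and polytopes\<close>

lemma illumination_number_eqI:
  fixes K :: "'a::euclidean_space set"
  assumes "sph_convex_body K" "2 \<le> DIM('a)" "illuminable (conic hull K) (DIM('a))"
  shows "illumination_number K = enat (DIM('a))"
  using illumination_number_le[OF assms(1,3,2)] illumination_number_ge[OF assms(1,2)] by simp

text \<open>Dimensions shift by one: \<open>F i\<close> gives a cone of dimension
  \<open>i + 1\<close>, so the flag starts at a three-dimensional cone and the cone over
  \<open>K\<close> itself is the last term. A face of \<open>K\<close> contained in another face of
  \<open>K\<close> is a face of that face, so each inclusion is a facet step.\<close>

lemma illuminable_flag:
  fixes K :: "'a::euclidean_space set"
  assumes K: "sph_convex_body K" and d: "DIM('a) = d + 1" "d > 2"
    and F: "\<And>i. 2 \<le> i \<Longrightarrow> i \<le> d - 1 \<Longrightarrow> sph_face (F i) K \<and> has_sph_dim (F i) i"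
    and sub: "\<And>i. 2 \<le> i \<Longrightarrow> i < d - 1 \<Longrightarrow> F i \<subseteq> F (i + 1)"
  shows "illuminable (conic hull K) (d + 1)"
proof -
  note D = sph_convex_bodyD[OF K]
  have face: "(conic hull F i) face_of (conic hull K)" "conic hull F i \<noteq> {}"
      "aff_dim (conic hull F i) = int i + 1" if "2 \<le> i" "i \<le> d - 1" for i
  proof -
    have i: "sph_face (F i) K" "has_sph_dim (F i) i" "sph_convex (F i)"
      using F[OF that] by (auto simp: sph_face_def)
    have ne: "F i \<noteq> {}" using has_sph_dim_conic_hull(1)[OF i(2,3)] that by simp
    then show "conic hull F i \<noteq> {}" by (simp add: conic_hull_eq_empty)
    show "(conic hull F i) face_of (conic hull K)"
      using K i ne by (intro face_of_conic_hull) (auto simp: sph_convex_body_def)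
    show "aff_dim (conic hull F i) = int i + 1"
      using has_sph_dim_conic_hull(2)[OF i(2,3)] that by simp
  qed
  have pc: "pointed_cone (conic hull F i)" if "2 \<le> i" "i \<le> d - 1" for i
    using pointed_cone_face[OF D(4) face(1,2)[OF that]] .
  have "illuminable (conic hull F i) (Suc i)" if "2 \<le> i" "i \<le> d - 1" for i
    using that
  proof (induction i rule: nat_induct_at_least)
    case base
    then show ?case
      using illuminable_dim_3[of "conic hull F 2"] pc[of 2] face(3)[of 2] by (simp add: numeral_3_eq_3)
  next
    case (Suc i)
    have "conic hull F i \<subseteq> conic hull F (Suc i)"
      using sub[of i] Suc by (intro hull_mono) auto
    moreover have "conic hull F (Suc i) \<subseteq> conic hull K"
      using face(1)[of "Suc i"] Suc by (intro face_of_imp_subset) auto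
    moreover have "(conic hull F i) face_of (conic hull K)" using face(1)[of i] Suc by auto
    ultimately have "(conic hull F i) face_of (conic hull F (Suc i))"
      using face_of_subset by blast
    moreover have "aff_dim (conic hull F (Suc i)) = aff_dim (conic hull F i) + 1"
      using face(3)[of i] face(3)[of "Suc i"] Suc by simp
    ultimately show ?case
      using face(2)[of i] Suc by (intro illuminable_face[OF pc]) auto
  qed
  from this[of "d - 1"] have "illuminable (conic hull F (d - 1)) (Suc (d - 1))"
    using d by simp
  then have "illuminable (conic hull K) (Suc (Suc (d - 1)))"
    using face[of "d - 1"] d D(8) by (intro illuminable_face[OF D(4)]) auto
  then show ?thesis using d by simp
qed

text \<open>The sign of a linear functional is unchanged by positive scaling, so each closed
  hemisphere extends to a closed half-space with the origin on its boundary hyperplane.\<close>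

lemma polyhedron_conic_hull_sph_polytope:
  fixes P :: "'a::euclidean_space set"
  assumes P: "sph_convex_polytope P"
  shows "polyhedron (conic hull P)"
proof -
  have K: "sph_convex_body P" using P by (simp add: sph_convex_polytope_def)
  note D = sph_convex_bodyD[OF K]
  obtain \<H> where \<H>: "finite \<H>" "\<And>H. H \<in> \<H> \<Longrightarrow> closed_hemisphere H" "P = usphere \<inter> \<Inter>\<H>"
    using P unfolding sph_convex_polytope_def by blast
  have *: "\<forall>H\<in>\<H>. \<exists>a. H = {x \<in> usphere. 0 \<le> a \<bullet> x}"
    using \<H>(2) unfolding closed_hemisphere_def by blast
  obtain a where a: "\<And>H. H \<in> \<H> \<Longrightarrow> H = {x \<in> usphere. 0 \<le> a H \<bullet> x}"
    using bchoice[OF *] by blast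
  have "conic hull P = \<Inter> ((\<lambda>H. {x. 0 \<le> a H \<bullet> x}) ` \<H>)"
  proof (rule set_eqI)
    fix x
    have "sgn x \<in> P \<longleftrightarrow> (\<forall>H\<in>\<H>. 0 \<le> a H \<bullet> x)" if "x \<noteq> 0"
    proof -
      have "sgn x \<in> H \<longleftrightarrow> 0 \<le> a H \<bullet> x" if "H \<in> \<H>" for H
      proof -
        have "sgn x \<in> H \<longleftrightarrow> sgn x \<in> usphere \<and> 0 \<le> a H \<bullet> sgn x" using a[OF that] by blast
        moreover have "sgn x \<in> usphere" using \<open>x \<noteq> 0\<close> by (simp add: norm_sgn)
        moreover have "0 \<le> a H \<bullet> sgn x \<longleftrightarrow> 0 \<le> a H \<bullet> x"
          using \<open>x \<noteq> 0\<close> by (simp add: sgn_div_norm zero_le_mult_iff zero_le_divide_iff)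
        ultimately show ?thesis by blast
      qed
      then show ?thesis using \<H>(3) that by (auto simp: norm_sgn)
    qed
    then show "x \<in> conic hull P \<longleftrightarrow> x \<in> \<Inter> ((\<lambda>H. {x. 0 \<le> a H \<bullet> x}) ` \<H>)"
      using mem_conic_hull_iff[OF D(1,2)] by (cases "x = 0") auto
  qed
  moreover have "polyhedron {x. 0 \<le> a H \<bullet> x}" for H
    using polyhedron_halfspace_ge[of 0 "a H"] by simp
  ultimately show ?thesis using \<H>(1) by (auto intro: polyhedron_Inter)
qed

theorem theorem1:
  fixes d :: nat
  assumes "DIM('a::euclidean_space) = d + 1"
    and "d > 2"
  shows "(\<forall>K::'a set. sph_convex_body K \<and>
             (\<exists>F :: nat \<Rightarrow> 'a set.
                (\<forall>i\<in>{2..d - 1}. sph_face (F i) K \<and> has_sph_dim (F i) i) \<and>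
                (\<forall>i\<in>{2..<d - 1}. F i \<subseteq> F (i + 1)))
           \<longrightarrow> illumination_number K = enat (d + 1)) \<and>
         (\<forall>P::'a set. sph_convex_polytope P \<longrightarrow> illumination_number P = enat (d + 1))"
proof (intro conjI allI impI)
  fix K :: "'a set"
  assume *: "sph_convex_body K \<and>
             (\<exists>F :: nat \<Rightarrow> 'a set.
                (\<forall>i\<in>{2..d - 1}. sph_face (F i) K \<and> has_sph_dim (F i) i) \<and>
                (\<forall>i\<in>{2..<d - 1}. F i \<subseteq> F (i + 1)))"
  then obtain F :: "nat \<Rightarrow> 'a set" where K: "sph_convex_body K"
    and F: "\<forall>i\<in>{2..d - 1}. sph_face (F i) K \<and> has_sph_dim (F i) i"
      "\<forall>i\<in>{2..<d - 1}. F i \<subseteq> F (i + 1)"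
    by blast
  have "illuminable (conic hull K) (d + 1)"
    by (rule illuminable_flag[OF K assms, of F]) (use F in auto)
  then show "illumination_number K = enat (d + 1)"
    using illumination_number_eqI[OF K] assms by simp
next
  fix P :: "'a set"
  assume P: "sph_convex_polytope P"
  then have K: "sph_convex_body P" by (simp add: sph_convex_polytope_def)
  \<comment> \<open>Rather than exhibiting a flag of spherical faces of \<open>P\<close>, the
    induction over facets is run directly on its polyhedral cone.\<close>
  have "illuminable (conic hull P) (d + 1)"
    using sph_convex_bodyD[OF K] P assms
    by (intro illuminable_polyhedron polyhedron_conic_hull_sph_polytope) auto
  then show "illumination_number P = enat (d + 1)"
    using illumination_number_eqI[OF K] assms by simp
qed

end
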